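(* Let $x_1,x_2,\dots$ be independent identically distributed random variables in $[0,1]$ with common probability density $f$ such that $f(x)/(c x^{\beta})\to1$ as $x\to0^+$, where $c>0$, and suppose $\alpha=1+\beta$ satisfies $0<\alpha<1$. Let $H_n$ be the harmonic mean of $x_1,\dots,x_n$. Then $H_n/n^{1-1/\alpha}$ converges in distribution to the (positive) random variable with distribution function $x\mapsto1-G(1/x)$ for $x>0$, where $G$ is the unbalanced stable distribution of exponent $\alpha$ that is the limit in distribution of $Y_n=n^{1-1/\alpha}/H_n$.
   Context: The harmonic mean is given by $\frac1{H_n}=\frac1n\sum_{i=1}^n\frac1{x_i}$. A stable law $G$ of exponent $\alpha\in(0,2)$ has tails $x^{\alpha}(1-G(x))\to Cp$, $x^{\alpha}G(-x)\to Cq$ as $x\to+\infty$, with $C>0$, $p,q\ge0$, $p+q=1$; it is unbalanced if $p=1$ or $q=1$ (here $p=1$). *)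

theory Defs
  imports "HOL-Probability.Probability"
begin

definition harmonic_mean :: "nat \<Rightarrow> (nat \<Rightarrow> real) \<Rightarrow> real" where
  "harmonic_mean n x = inverse ((1 / real n) * (\<Sum>i<n. 1 / x i))"

(* Stability with the norming constants n^(1/\<alpha>) that define the exponent; degenerate laws
   are excluded. The left-hand measure is the law of the sum of n independent copies. *)
definition stable_law :: "real \<Rightarrow> real measure \<Rightarrow> bool" where
  "stable_law \<alpha> G \<longleftrightarrow>
     real_distribution G \<and> (\<forall>a. G \<noteq> return borel a) \<and>
     (\<forall>n\<ge>1. \<exists>d.
        distr (PiM {..<n} (\<lambda>_. G)) borel (\<lambda>y. \<Sum>i<n. y i) =
        distr G borel (\<lambda>y. real n powr (1 / \<alpha>) * y + d))"

(* p and q are the tail weights at +\<infinity> and -\<infinity>;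
   the law is unbalanced when p = 1 or q = 1. *)
definition stable_law_weights :: "real \<Rightarrow> real \<Rightarrow> real \<Rightarrow> real measure \<Rightarrow> bool" where
  "stable_law_weights \<alpha> p q G \<longleftrightarrow>
     0 < \<alpha> \<and> \<alpha> < 2 \<and> 0 \<le> p \<and> 0 \<le> q \<and> p + q = 1 \<and> stable_law \<alpha> G \<and>
     (\<exists>C>0. ((\<lambda>x. x powr \<alpha> * (1 - cdf G x)) \<longlongrightarrow> C * p) at_top \<and>
            ((\<lambda>x. x powr \<alpha> * cdf G (- x)) \<longlongrightarrow> C * q) at_top)"

end

theory Submission
  imports Defs "HOL-Real_Asymp.Real_Asymp"
begin

text \<open>
  Put \<open>b\<^sub>n = n powr (1 / a)\<close>. Substituting \<open>x = y / b\<^sub>n\<close> in an integral against the density shows that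
  \<open>n * E (g (b\<^sub>n * X))\<close> tends to \<open>c * \<integral> y powr (a - 1) * g y dy\<close> over \<open>y > 0\<close>, for every \<open>g\<close> dominated
  by \<open>min 1 (1 / y)\<close>. With \<open>g y = 1 - exp (\<i> * t / y)\<close> this gives the limit \<open>exp (- c * \<Psi> t)\<close> of the
  characteristic functions of the scaled sums of the \<open>1 / X\<^sub>i\<close>, where
  \<open>\<Psi> (s * t) = s powr a * \<Psi> t\<close> for \<open>s > 0\<close>; stability is read off from this scaling. With the
  indicator of \<open>y \<le> v\<close> and with \<open>1 / y\<close> restricted to \<open>y \<ge> v\<close> it controls the tails: a
  scaled sum exceeds \<open>x\<close> essentially only if one summand does, and this yields tightness (hence
  existence of the limit law) as well as the tail constant \<open>c / a\<close>. The limit law has no atoms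
  because its characteristic function vanishes at infinity, so inversion is a continuous map
  almost everywhere and the law of the reciprocal converges too.
\<close>

subsection \<open>Rescaled integrals against a regularly varying density\<close>

lemma has_bochner_integral_powr_near_0:
  fixes a v :: real
  assumes "0 < a" "0 \<le> v"
  shows "has_bochner_integral lborel (\<lambda>x. indicator {0..v} x * x powr (a - 1)) (v powr a / a)"
proof (rule has_bochner_integral_nn_integral)
  have "((\<lambda>x. x powr (a - 1)) has_integral (v powr (a - 1 + 1) / (a - 1 + 1))) {0..v}"
    using assms by (intro has_integral_powr_from_0) auto
  from nn_integral_has_integral_lebesgue[OF _ this]
  show "(\<integral>\<^sup>+ x. ennreal (indicator {0..v} x * x powr (a - 1)) \<partial>lborel) = ennreal (v powr a / a)"
    by simp
qed (use assms in auto)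

lemma has_bochner_integral_powr_at_top:
  fixes e v :: real
  assumes "e < - 1" "0 < v"
  shows "has_bochner_integral lborel (\<lambda>x. indicator {v..} x * x powr e) (- (v powr (e + 1)) / (e + 1))"
proof (rule has_bochner_integral_nn_integral)
  from nn_integral_has_integral_lebesgue[OF _ has_integral_powr_to_inf[OF assms]]
  show "(\<integral>\<^sup>+ x. ennreal (indicator {v..} x * x powr e) \<partial>lborel)
      = ennreal (- (v powr (e + 1)) / (e + 1))"
    by simp
  show "0 \<le> - (v powr (e + 1)) / (e + 1)"
    using assms by (simp add: divide_nonneg_neg)
qed auto

text \<open>At 0 the weight itself is integrable because a - 1 > -1; at infinity the decay 1 / y of
  \<open>g\<close> lowers the exponent to a - 2 < -1.\<close>

lemma integrable_powr_weight:
  fixes a C :: real and g :: "real \<Rightarrow> 'b::{banach, second_countable_topology}"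
  assumes a: "0 < a" "a < 1" and [measurable]: "g \<in> borel_measurable borel"
    and g0: "\<And>y. y \<le> 0 \<Longrightarrow> g y = 0" and gb: "\<And>y. 0 < y \<Longrightarrow> norm (g y) \<le> C * min 1 (1 / y)"
  shows "integrable lborel (\<lambda>y. y powr (a - 1) *\<^sub>R g y)"
proof (rule Bochner_Integration.integrable_bound)
  show "integrable lborel (\<lambda>y. C * (indicator {0..1} y * y powr (a - 1) + indicator {1..} y * y powr (a - 2)))"
    using has_bochner_integral_powr_near_0[of a 1] has_bochner_integral_powr_at_top[of "a - 2" 1] a
    by (auto intro!: integrable_mult_right Bochner_Integration.integrable_add intro: integrable.intros)
  have C: "0 \<le> C" using order_trans[OF norm_ge_zero gb[of 1]] by simp
  show "AE y in lborel. norm (y powr (a - 1) *\<^sub>R g y) \<le>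
      norm (C * (indicator {0..1} y * y powr (a - 1) + indicator {1..} y * y powr (a - 2)))"
  proof (intro AE_I2)
    fix y :: real
    let ?r = "C * (indicator {0..1} y * y powr (a - 1) + indicator {1..} y * y powr (a - 2))"
    have "norm (y powr (a - 1) *\<^sub>R g y) \<le> ?r"
    proof (cases "y \<le> 0")
      case True
      then show ?thesis using C by (simp add: g0)
    next
      case False
      then have y: "0 < y" by simp
      have "norm (y powr (a - 1) *\<^sub>R g y) \<le> y powr (a - 1) * (C * min 1 (1 / y))"
        using gb[OF y] by (simp add: mult_left_mono)
      also have "\<dots> = C * (y powr (a - 1) * min 1 (1 / y))" by simp
      also have "y powr (a - 1) * min 1 (1 / y) \<le>
          indicator {0..1} y * y powr (a - 1) + indicator {1..} y * y powr (a - 2)"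
      proof (cases "y \<le> 1")
        case True
        then show ?thesis using y by (simp add: indicator_def mult_left_le)
      next
        case False
        have "y powr (a - 2) = y powr (a - 1) / y"
          using y by (simp add: powr_diff power2_eq_square powr_numeral)
        then show ?thesis using False y by (simp add: indicator_def min_def)
      qed
      finally show ?thesis using C by (simp add: mult_left_mono)
    qed
    also have "?r \<le> norm ?r" by simp
    finally show "norm (y powr (a - 1) *\<^sub>R g y) \<le> norm ?r" .
  qed
qed simp

text \<open>The asymptotics of \<open>f\<close> are known only near 0, so the integral is split at a
  small \<open>d\<close>. Below \<open>d\<close>, substitution and dominated convergence give the
  limit; above \<open>d\<close>, the decay of \<open>g\<close> makes the contribution
  vanish.\<close>

lemma rescaled_integral_limit:
  fixes a c C :: real and f :: "real \<Rightarrow> real" and g :: "real \<Rightarrow> 'b::{banach, second_countable_topology}"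
  assumes a: "0 < a" "a < 1" and c: "0 < c"
    and [measurable]: "f \<in> borel_measurable borel" and f0: "\<And>x. 0 \<le> f x" and fint: "integrable lborel f"
    and lim: "((\<lambda>x. f x / (c * x powr (a - 1))) \<longlongrightarrow> 1) (at_right 0)"
    and [measurable]: "g \<in> borel_measurable borel"
    and g0: "\<And>y. y \<le> 0 \<Longrightarrow> g y = 0" and gb: "\<And>y. 0 < y \<Longrightarrow> norm (g y) \<le> C * min 1 (1 / y)"
  shows "(\<lambda>n. real n *\<^sub>R (\<integral>x. f x *\<^sub>R g (real n powr (1 / a) * x) \<partial>lborel))
    \<longlonglongrightarrow> c *\<^sub>R (\<integral>y. y powr (a - 1) *\<^sub>R g y \<partial>lborel)"
proof -
  define b where "b n = real n powr (1 / a)" for n :: nat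
  have b_pos: "0 < b n" if "0 < n" for n using that by (simp add: b_def)
  have b_a: "b n powr a = n" if "0 < n" for n using that a by (simp add: b_def powr_powr)
  have C: "0 \<le> C" using order_trans[OF norm_ge_zero gb[of 1]] by simp
  have gC: "norm (g y) \<le> C" for y
  proof (cases "0 < y")
    case True
    have "C * min 1 (1 / y) \<le> C * 1" using C by (intro mult_left_mono) auto
    with gb[OF True] show ?thesis by simp
  qed (use C g0[of y] in auto)
  \<comment> \<open>Tolerance 1 keeps the ratio below 2; this constant enters the dominating
    function.\<close>
  from tendstoD[OF lim, of 1] obtain d where d: "0 < d"
    and fd: "\<And>x. 0 < x \<Longrightarrow> x < d \<Longrightarrow> dist (f x / (c * x powr (a - 1))) 1 < 1"
    by (auto simp: eventually_at_right_field)
  have fle: "f x \<le> 2 * c * x powr (a - 1)" if "0 < x" "x < d" for x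
  proof -
    have "f x / (c * x powr (a - 1)) \<le> 2" using fd[OF that] by (simp add: dist_real_def abs_less_iff)
    then show ?thesis using c that by (simp add: divide_le_eq mult_ac)
  qed
  have int: "integrable lborel (\<lambda>x. indicator A x *\<^sub>R f x *\<^sub>R g (b n * x))"
    if [measurable]: "A \<in> sets borel" for n A
  proof (rule Bochner_Integration.integrable_bound[OF integrable_mult_right[OF fint, of C]])
    show "AE x in lborel. norm (indicator A x *\<^sub>R f x *\<^sub>R g (b n * x)) \<le> norm (C * f x)"
      using f0 gC C by (auto simp: indicator_def abs_mult mult.commute[of C] intro!: AE_I2 mult_left_mono)
  qed simp
  have near: "(\<lambda>n. real n *\<^sub>R (\<integral>x. indicator {..<d} x *\<^sub>R f x *\<^sub>R g (b n * x) \<partial>lborel))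
    \<longlonglongrightarrow> c *\<^sub>R (\<integral>y. y powr (a - 1) *\<^sub>R g y \<partial>lborel)"
  proof -
    define h where "h n y = indicator {..<d} (y / b n) *\<^sub>R ((real n / b n * f (y / b n)) *\<^sub>R g y)" for n y
    have eq: "real n *\<^sub>R (\<integral>x. indicator {..<d} x *\<^sub>R f x *\<^sub>R g (b n * x) \<partial>lborel)
        = (\<integral>y. h n y \<partial>lborel)" for n
    proof (cases "n = 0")
      case True
      then show ?thesis by (simp add: h_def)
    next
      case False
      then have b: "0 < b n" by (simp add: b_pos)
      have "(\<integral>x. indicator {..<d} x *\<^sub>R f x *\<^sub>R g (b n * x) \<partial>lborel)
          = \<bar>1 / b n\<bar> *\<^sub>R (\<integral>y. indicator {..<d} (0 + 1 / b n * y) *\<^sub>R f (0 + 1 / b n * y) *\<^sub>R g (b n * (0 + 1 / b n * y)) \<partial>lborel)"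
        using b by (intro lborel_integral_real_affine) auto
      then have "real n *\<^sub>R (\<integral>x. indicator {..<d} x *\<^sub>R f x *\<^sub>R g (b n * x) \<partial>lborel)
          = (real n / b n) *\<^sub>R (\<integral>y. indicator {..<d} (y / b n) *\<^sub>R f (y / b n) *\<^sub>R g y \<partial>lborel)"
        using b by simp
      also have "\<dots> = (\<integral>y. (real n / b n) *\<^sub>R indicator {..<d} (y / b n) *\<^sub>R f (y / b n) *\<^sub>R g y \<partial>lborel)"
        by (rule integral_scaleR_right[symmetric])
      also have "\<dots> = (\<integral>y. h n y \<partial>lborel)"
        by (intro Bochner_Integration.integral_cong) (auto simp: h_def mult_ac)
      finally show ?thesis .
    qed
    \<comment> \<open>The norming is chosen for this identity: since \<open>b n powr a = n\<close>,
      the factor n / b_n left by the substitution equals b_n^(a - 1), which is what homogeneity of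
      the power weight requires.\<close>
    have weight: "real n / b n = (y powr (a - 1)) / ((y / b n) powr (a - 1))" if "0 < n" "0 < y" for n y
      using b_pos[OF \<open>0 < n\<close>] b_a[OF \<open>0 < n\<close>] that
      by (simp add: powr_divide powr_diff)
    have "(\<lambda>n. \<integral>y. h n y \<partial>lborel) \<longlonglongrightarrow> (\<integral>y. (c * y powr (a - 1)) *\<^sub>R g y \<partial>lborel)"
    proof (rule integral_dominated_convergence)
      show "(\<lambda>y. (c * y powr (a - 1)) *\<^sub>R g y) \<in> borel_measurable lborel" by simp
      show "h n \<in> borel_measurable lborel" for n unfolding h_def by simp
      show "integrable lborel (\<lambda>y. 2 * c * norm (y powr (a - 1) *\<^sub>R g y))"
        by (intro integrable_mult_right integrable_norm integrable_powr_weight[OF a _ g0 gb]) auto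
      show "AE y in lborel. norm (h n y) \<le> 2 * c * norm (y powr (a - 1) *\<^sub>R g y)" for n
      proof (intro AE_I2)
        fix y
        show "norm (h n y) \<le> 2 * c * norm (y powr (a - 1) *\<^sub>R g y)"
        proof (cases "0 < n \<and> 0 < y \<and> y / b n < d")
          case True
          then have n: "0 < n" and y: "0 < y" "y / b n < d" by auto
          have p: "0 < y / b n" using y b_pos[OF n] by simp
          have "norm (h n y) = real n / b n * f (y / b n) * norm (g y)"
            using y b_pos[OF n] f0 by (simp add: h_def)
          also have "\<dots> \<le> real n / b n * (2 * c * (y / b n) powr (a - 1)) * norm (g y)"
            using fle[OF p y(2)] b_pos[OF n] by (intro mult_right_mono mult_left_mono) auto
          also have "\<dots> = 2 * c * norm (y powr (a - 1) *\<^sub>R g y)"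
          proof -
            have "real n / b n * (y / b n) powr (a - 1) = y powr (a - 1)"
              unfolding weight[OF n y(1)] using y b_pos[OF n] by simp
            then have "real n / b n * (2 * c * (y / b n) powr (a - 1)) * norm (g y)
                = 2 * c * (y powr (a - 1) * norm (g y))"
              by (metis (no_types) mult.assoc mult.commute)
            then show ?thesis by simp
          qed
          finally show ?thesis .
        next
          case False
          then have "h n y = 0" by (auto simp: h_def b_def g0 not_less)
          then show ?thesis using c by simp
        qed
      qed
      show "AE y in lborel. (\<lambda>n. h n y) \<longlonglongrightarrow> (c * y powr (a - 1)) *\<^sub>R g y"
      proof (intro AE_I2)
        fix y
        show "(\<lambda>n. h n y) \<longlonglongrightarrow> (c * y powr (a - 1)) *\<^sub>R g y"
        proof (cases "0 < y")
          case True
          have "filterlim b at_top sequentially"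
            unfolding b_def using a by real_asymp
          \<comment> \<open>At fixed y > 0 the argument y / b_n tends to 0 from the right, so the
            density ratio there tends to 1.\<close>
          then have q: "filterlim (\<lambda>n. y / b n) (at_right 0) sequentially"
            using True unfolding b_def using a by real_asymp
          have "(\<lambda>n. (c * y powr (a - 1) * (f (y / b n) / (c * (y / b n) powr (a - 1)))) *\<^sub>R g y)
              \<longlonglongrightarrow> (c * y powr (a - 1) * 1) *\<^sub>R g y"
            by (intro tendsto_intros filterlim_compose[OF lim q])
          moreover have "\<forall>\<^sub>F n in sequentially. h n y =
              (c * y powr (a - 1) * (f (y / b n) / (c * (y / b n) powr (a - 1)))) *\<^sub>R g y"
          proof -
            have "\<forall>\<^sub>F n in sequentially. y / b n < d"
              using q d by (auto simp: filterlim_at intro: order_tendstoD)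
            moreover have "\<forall>\<^sub>F n in sequentially. 0 < (n::nat)" by (rule eventually_gt_at_top)
            ultimately show ?thesis
            proof eventually_elim
              case (elim n)
              then show ?case using c by (simp add: h_def weight[OF elim(2) True])
            qed
          qed
          ultimately show ?thesis by (subst tendsto_cong) auto
        qed (simp add: h_def g0)
      qed
    qed
    moreover have "(\<integral>y. (c * y powr (a - 1)) *\<^sub>R g y \<partial>lborel) = c *\<^sub>R (\<integral>y. y powr (a - 1) *\<^sub>R g y \<partial>lborel)"
      by (subst integral_scaleR_right[symmetric]) simp
    ultimately show ?thesis unfolding eq by simp
  qed
  \<comment> \<open>For x \<ge> d the value of \<open>g\<close> is at most C / (b_n d), so this part
    is of order n^(1 - 1 / a), which tends to 0 because a < 1.\<close>
  have far: "(\<lambda>n. real n *\<^sub>R (\<integral>x. indicator {d..} x *\<^sub>R f x *\<^sub>R g (b n * x) \<partial>lborel)) \<longlonglongrightarrow> 0"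
  proof (rule Lim_null_comparison)
    show "(\<lambda>n. real n * (C / (b n * d) * (\<integral>x. f x \<partial>lborel))) \<longlonglongrightarrow> 0"
    proof -
      have "(\<lambda>n. real n / real n powr (1 / a)) \<longlonglongrightarrow> 0"
        using a by real_asymp
      from tendsto_mult_right[OF this, of "C / d * (\<integral>x. f x \<partial>lborel)"]
      show ?thesis by (simp add: b_def mult_ac)
    qed
    show "\<forall>\<^sub>F n in sequentially. norm (real n *\<^sub>R (\<integral>x. indicator {d..} x *\<^sub>R f x *\<^sub>R g (b n * x) \<partial>lborel))
        \<le> real n * (C / (b n * d) * (\<integral>x. f x \<partial>lborel))"
      using eventually_gt_at_top[of 0]
    proof eventually_elim
      case (elim n)
      have "norm (\<integral>x. indicator {d..} x *\<^sub>R f x *\<^sub>R g (b n * x) \<partial>lborel)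
          \<le> (\<integral>x. C / (b n * d) * f x \<partial>lborel)"
      proof (rule Bochner_Integration.integral_norm_bound_integral)
        show "integrable lborel (\<lambda>x. C / (b n * d) * f x)" by (intro integrable_mult_right fint)
        fix x
        show "norm (indicator {d..} x *\<^sub>R f x *\<^sub>R g (b n * x)) \<le> C / (b n * d) * f x"
        proof (cases "d \<le> x")
          case True
          have "b n * d \<le> b n * x" using True b_pos[OF elim] by simp
          moreover have "0 < b n * d" using d b_pos[OF elim] by simp
          ultimately have "C * min 1 (1 / (b n * x)) \<le> C * (1 / (b n * d))"
            using C by (intro mult_left_mono) (auto simp: min_def divide_left_mono intro!: frac_le)
          moreover have "norm (g (b n * x)) \<le> C * min 1 (1 / (b n * x))"
            using True d b_pos[OF elim] by (intro gb) simp
          ultimately have "norm (g (b n * x)) \<le> C / (b n * d)" by simp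
          then have "f x * norm (g (b n * x)) \<le> f x * (C / (b n * d))"
            using f0[of x] by (rule mult_left_mono)
          then show ?thesis using True f0[of x] by (simp add: mult_ac)
        next
          case False
          then show ?thesis using f0[of x] C d b_pos[OF elim] by simp
        qed
      qed (rule int, simp)
      then have "norm (\<integral>x. indicator {d..} x *\<^sub>R f x *\<^sub>R g (b n * x) \<partial>lborel)
          \<le> C / (b n * d) * (\<integral>x. f x \<partial>lborel)" by (simp only: integral_mult_right_zero)
      then show ?case unfolding norm_scaleR by (simp only: abs_of_nat) (rule mult_left_mono, simp_all)
    qed
  qed
  have "(\<integral>x. f x *\<^sub>R g (b n * x) \<partial>lborel) = (\<integral>x. indicator {..<d} x *\<^sub>R f x *\<^sub>R g (b n * x) \<partial>lborel)
      + (\<integral>x. indicator {d..} x *\<^sub>R f x *\<^sub>R g (b n * x) \<partial>lborel)" for n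
    by (subst Bochner_Integration.integral_add[symmetric, OF int int])
       (auto intro!: Bochner_Integration.integral_cong simp: indicator_def)
  with tendsto_add[OF near far] show ?thesis by (simp add: b_def scaleR_add_right)
qed

subsection \<open>Characteristic exponent and absence of atoms\<close>

text \<open>With u = 1 / y this is the Levy-Khintchine integral of (1 - exp(i t u)) u^(-a - 1) over
  u > 0, the exponent of a one-sided stable law. For 0 < a < 1 it converges without a centering
  term.\<close>

definition stable_exponent :: "real \<Rightarrow> real \<Rightarrow> complex" where
  "stable_exponent a t =
     (\<integral>y. y powr (a - 1) *\<^sub>R (indicator {0<..} y *\<^sub>R (1 - iexp (t / y))) \<partial>lborel)"

lemma norm_one_minus_iexp_le:
  assumes "0 < y"
  shows "norm (1 - iexp (t / y)) \<le> (2 + \<bar>t\<bar>) * min 1 (1 / y)"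
proof -
  have "norm (1 - iexp (t / y)) \<le> 2"
    using norm_triangle_ineq4[of 1 "iexp (t / y)"] by simp
  moreover have "norm (1 - iexp (t / y)) \<le> \<bar>t\<bar> * (1 / y)"
    using iexp_approx1[of "t / y" 0] assms by (simp add: norm_minus_commute)
  moreover have "\<bar>t\<bar> * (1 / y) \<le> (2 + \<bar>t\<bar>) * (1 / y)"
    using assms by (intro mult_right_mono) auto
  ultimately show ?thesis by (auto simp: min_def)
qed

lemma integrable_stable_exponent:
  assumes "0 < a" "a < 1"
  shows "integrable lborel (\<lambda>y. y powr (a - 1) *\<^sub>R (indicator {0<..} y *\<^sub>R (1 - iexp (t / y))))"
  using assms norm_one_minus_iexp_le[of _ t]
  by (intro integrable_powr_weight[where C="2 + \<bar>t\<bar>"]) auto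

text \<open>Substituting s y for y produces a factor s from dy and s^(a - 1) from the weight, while
  the exponential depends only on the quotient. Both stability and the decay of the limit
  characteristic function come from this.\<close>

lemma stable_exponent_scale:
  assumes "0 < s"
  shows "stable_exponent a (s * t) = s powr a *\<^sub>R stable_exponent a t"
proof -
  have "stable_exponent a (s * t) = \<bar>s\<bar> *\<^sub>R (\<integral>y. (0 + s * y) powr (a - 1) *\<^sub>R
      (indicator {0<..} (0 + s * y) *\<^sub>R (1 - iexp (s * t / (0 + s * y)))) \<partial>lborel)"
    unfolding stable_exponent_def using assms by (intro lborel_integral_real_affine) simp
  also have "\<dots> = s *\<^sub>R (\<integral>y. s powr (a - 1) *\<^sub>R (y powr (a - 1) *\<^sub>R
      (indicator {0<..} y *\<^sub>R (1 - iexp (t / y)))) \<partial>lborel)"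
  proof -
    have "(0 + s * y) powr (a - 1) *\<^sub>R (indicator {0<..} (0 + s * y) *\<^sub>R (1 - iexp (s * t / (0 + s * y))))
      = s powr (a - 1) *\<^sub>R (y powr (a - 1) *\<^sub>R (indicator {0<..} y *\<^sub>R (1 - iexp (t / y))))" for y
      using assms by (cases "0 < y") (auto simp: powr_mult indicator_def zero_less_mult_iff)
    then show ?thesis by (simp only: abs_of_pos[OF assms])
  qed
  also have "\<dots> = s powr a *\<^sub>R stable_exponent a t"
    using assms by (simp only: integral_scaleR_right) (simp add: stable_exponent_def powr_diff)
  finally show ?thesis .
qed

lemma Re_stable_exponent:
  assumes "0 < a" "a < 1"
  shows "has_bochner_integral lborel (\<lambda>y. indicator {0<..} y * (y powr (a - 1) * (1 - cos (t / y))))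
    (Re (stable_exponent a t))"
proof -
  from has_bochner_integral_Re[OF has_bochner_integral_integrable[OF integrable_stable_exponent[OF assms, of t]]]
  have "has_bochner_integral lborel
    (\<lambda>y. Re (y powr (a - 1) *\<^sub>R (indicator {0<..} y *\<^sub>R (1 - iexp (t / y))))) (Re (stable_exponent a t))"
    by (simp only: stable_exponent_def)
  moreover have "Re (y powr (a - 1) *\<^sub>R (indicator {0<..} y *\<^sub>R (1 - iexp (t / y))))
    = indicator {0<..} y * (y powr (a - 1) * (1 - cos (t / y)))" for y
    by (simp add: Re_exp)
  ultimately show ?thesis by (simp only:)
qed

lemma Re_stable_exponent_nonneg:
  assumes "0 < a" "a < 1"
  shows "0 \<le> Re (stable_exponent a t)"
  unfolding has_bochner_integral_integral_eq[OF Re_stable_exponent[OF assms, of t], symmetric]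
  by (intro Bochner_Integration.integral_nonneg) simp

lemma Re_stable_exponent_pos:
  assumes a: "0 < a" "a < 1"
  shows "0 < Re (stable_exponent a 1)"
proof -
  \<comment> \<open>\<open>?k\<close> bounds the integrand from below on [1, 2]: the power decreases
    there, and 1 / y stays in [1 / 2, 1], where cosine decreases.\<close>
  let ?k = "2 powr (a - 1) * (1 - cos (1 / 2 :: real))"
  have "cos (1 / 2 :: real) < cos 0"
    using pi_gt3 by (intro cos_monotone_0_pi) auto
  then have "0 < ?k" by simp
  also have "?k = (\<integral>y. indicator {1..2::real} y * ?k \<partial>lborel)" by simp
  also have "\<dots> \<le> (\<integral>y. indicator {0<..} y * (y powr (a - 1) * (1 - cos (1 / y))) \<partial>lborel)"
  proof (rule integral_mono)
    show "integrable lborel (\<lambda>y. indicator {0<..} y * (y powr (a - 1) * (1 - cos (1 / y))))"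
      using Re_stable_exponent[OF a, of 1] by (rule integrable.intros)
    show "integrable lborel (\<lambda>y. indicator {1..2::real} y * ?k)"
      by (auto intro!: integrable_mult_left integrable_real_indicator)
    fix y :: real
    show "indicator {1..2::real} y * ?k \<le> indicator {0<..} y * (y powr (a - 1) * (1 - cos (1 / y)))"
    proof (cases "y \<in> {1..2}")
      case True
      have "cos (1 / y) \<le> cos (1 / 2)"
      proof (rule cos_monotone_0_pi_le)
        have "1 / y \<le> 1" using True by (simp add: divide_le_eq)
        then show "1 / y \<le> pi" using pi_gt3 by linarith
      qed (use True in \<open>auto simp: field_simps\<close>)
      moreover have "2 powr (a - 1) \<le> y powr (a - 1)"
        using True a by (intro powr_mono2') auto
      ultimately have "?k \<le> y powr (a - 1) * (1 - cos (1 / y))"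
        by (intro mult_mono) auto
      then show ?thesis using True by simp
    qed simp
  qed
  also have "\<dots> = Re (stable_exponent a 1)"
    using Re_stable_exponent[OF a, of 1] by (rule has_bochner_integral_integral_eq)
  finally show ?thesis .
qed

text \<open>No complex logarithm is taken: w_n is compared with exp(-z / n), whose n-th power is
  exp(-z). Both lie in the closed unit disc, the latter because Re z \<ge> 0, so their n-th powers
  differ by at most n times their distance.\<close>

lemma power_tendsto_exp:
  fixes z :: complex and w :: "nat \<Rightarrow> complex"
  assumes w: "\<And>n. norm (w n) \<le> 1" and z: "0 \<le> Re z" and lim: "(\<lambda>n. of_nat n * (1 - w n)) \<longlonglongrightarrow> z"
  shows "(\<lambda>n. w n ^ n) \<longlonglongrightarrow> exp (- z)"
proof -
  have 1: "(\<lambda>n. of_nat n * (1 - exp (- z / of_nat n))) \<longlonglongrightarrow> z"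
  proof (cases "z = 0")
    case False
    have "(\<lambda>n. - z / of_nat n) \<longlonglongrightarrow> 0" by (rule lim_const_over_n)
    then have "filterlim (\<lambda>n. - z / of_nat n) (at 0) sequentially"
      using False by (auto simp: filterlim_at intro!: eventually_mono[OF eventually_gt_at_top[of 0]])
    from filterlim_compose[OF lim_exp_minus_1 this]
    have "(\<lambda>n. z * ((exp (- z / of_nat n) - 1) / (- z / of_nat n))) \<longlonglongrightarrow> z * 1"
      by (intro tendsto_mult tendsto_const)
    moreover have "z * ((exp (- z / of_nat n) - 1) / (- z / of_nat n)) = of_nat n * (1 - exp (- z / of_nat n))" for n
      using False by (cases "n = 0") (simp_all add: field_simps)
    ultimately show ?thesis by simp
  qed simp
  have "(\<lambda>n. w n ^ n - exp (- z / of_nat n) ^ n) \<longlonglongrightarrow> 0"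
  proof (rule Lim_null_comparison)
    show "\<forall>\<^sub>F n in sequentially. norm (w n ^ n - exp (- z / of_nat n) ^ n) \<le>
        norm (of_nat n * (1 - exp (- z / of_nat n)) - of_nat n * (1 - w n))"
    proof (intro always_eventually allI)
      fix n
      have "norm (w n ^ n - exp (- z / of_nat n) ^ n) \<le> n * norm (w n - exp (- z / of_nat n))"
        using w z by (intro norm_power_diff) (auto simp: norm_exp_eq_Re Re_divide_of_nat)
      also have "\<dots> = norm (of_nat n * (w n - exp (- z / of_nat n)))" by (simp add: norm_mult)
      also have "of_nat n * (w n - exp (- z / of_nat n)) = of_nat n * (1 - exp (- z / of_nat n)) - of_nat n * (1 - w n)"
        by (simp add: algebra_simps)
      finally show "norm (w n ^ n - exp (- z / of_nat n) ^ n) \<le>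
        norm (of_nat n * (1 - exp (- z / of_nat n)) - of_nat n * (1 - w n))" .
    qed
    show "(\<lambda>n. norm (of_nat n * (1 - exp (- z / of_nat n)) - of_nat n * (1 - w n))) \<longlonglongrightarrow> 0"
      using tendsto_norm[OF tendsto_diff[OF 1 lim]] by simp
  qed
  moreover have "(\<lambda>n. exp (- z / of_nat n) ^ n) \<longlonglongrightarrow> exp (- z)"
  proof (rule tendsto_eventually)
    show "\<forall>\<^sub>F n in sequentially. exp (- z / of_nat n) ^ n = exp (- z)"
      using eventually_gt_at_top[of 0] by eventually_elim (simp flip: exp_of_nat_mult)
  qed
  ultimately show ?thesis using tendsto_add by fastforce
qed

lemma (in real_distribution) char_uminus: "char M (- t) = cnj (char M t)"
proof -
  have "char M (- t) = (CLINT x|M. cnj (iexp (t * x)))"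
    by (simp add: char_def exp_cnj)
  also have "\<dots> = cnj (char M t)"
    unfolding char_def by simp
  finally show ?thesis .
qed

(* With e_k(y) = iexp (k T (y - x)), the sum of the N functions e_k has modulus N at y = x, while
   widely spaced frequencies make these functions almost orthogonal in L2(M). *)
lemma (in real_distribution) char_tendsto_0_imp_no_atom:
  assumes "(char M \<longlongrightarrow> 0) at_top"
  shows "measure M {x} = 0"
proof -
  have le: "measure M {x} \<le> 1 / real N + e" if e: "0 < e" and N: "0 < N" for e N
  proof -
    from tendstoD[OF assms e] obtain T0 where T0: "\<And>t. T0 \<le> t \<Longrightarrow> norm (char M t) < e"
      by (auto simp: eventually_at_top_linorder)
    \<comment> \<open>Keeping \<open>T\<close> at least 1 makes it positive, so that multiples of it
      by nonzero integers have modulus at least \<open>T\<close>; \<open>char_uminus\<close> extends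
      the bound to negative frequencies.\<close>
    define T where "T = max 1 T0"
    have T: "norm (char M t) \<le> e" if "T \<le> \<bar>t\<bar>" for t
    proof (cases "0 \<le> t")
      case False
      then have "norm (char M (- t)) \<le> e" using that T0[of "- t"] by (auto simp: T_def)
      then show ?thesis by (simp add: char_uminus)
    qed (use that T0[of t] in \<open>auto simp: T_def\<close>)
    define S where "S y = (\<Sum>k<N. iexp (real k * T * (y - x)))" for y
    have S2: "complex_of_real ((norm (S y))\<^sup>2) =
        (\<Sum>k<N. \<Sum>l<N. iexp (- ((real k - real l) * T * x)) * iexp ((real k - real l) * T * y))" for y
    proof -
      have "complex_of_real ((norm (S y))\<^sup>2) = S y * cnj (S y)"
        by (rule complex_norm_square)
      also have "\<dots> = (\<Sum>k<N. \<Sum>l<N. iexp (real k * T * (y - x)) * cnj (iexp (real l * T * (y - x))))"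
        unfolding S_def cnj_sum sum_product ..
      also have "\<dots> = (\<Sum>k<N. \<Sum>l<N. iexp (- ((real k - real l) * T * x)) * iexp ((real k - real l) * T * y))"
        by (intro sum.cong refl) (simp add: exp_cnj flip: exp_add, simp add: algebra_simps)
      finally show ?thesis .
    qed
    have bound: "norm (S y) \<le> real N" for y
      unfolding S_def by (rule order_trans[OF norm_sum]) simp
    have int: "integrable M (\<lambda>y. (norm (S y))\<^sup>2)"
    proof (rule integrable_const_bound[of _ "(real N)\<^sup>2"])
      show "AE y in M. norm ((norm (S y))\<^sup>2) \<le> (real N)\<^sup>2"
        by (auto intro!: AE_I2 power_mono bound)
    qed (simp add: S_def)
    have "(real N)\<^sup>2 * measure M {x} = (\<integral>y. (real N)\<^sup>2 * indicator {x} y \<partial>M)" by simp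
    also have "\<dots> \<le> (\<integral>y. (norm (S y))\<^sup>2 \<partial>M)"
    proof (rule integral_mono[OF _ int])
      show "integrable M (\<lambda>y. (real N)\<^sup>2 * indicator {x} y)"
        by (intro integrable_mult_right integrable_real_indicator) (auto simp: less_top[symmetric])
    qed (auto simp: indicator_def S_def)
    also have "\<dots> = Re (complex_of_real (\<integral>y. (norm (S y))\<^sup>2 \<partial>M))" by simp
    also have "complex_of_real (\<integral>y. (norm (S y))\<^sup>2 \<partial>M) = (CLINT y|M. complex_of_real ((norm (S y))\<^sup>2))"
      by (rule integral_complex_of_real[symmetric])
    also have "\<dots> = (\<Sum>k<N. \<Sum>l<N. CLINT y|M. iexp (- ((real k - real l) * T * x)) * iexp ((real k - real l) * T * y))"
      unfolding S2
      by (subst Bochner_Integration.integral_sum; (intro Bochner_Integration.integrable_sum)?;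
          (intro sum.cong refl Bochner_Integration.integral_sum)?; intro integrable_mult_right integrable_iexp; simp)
    also have "\<dots> = (\<Sum>k<N. \<Sum>l<N. iexp (- ((real k - real l) * T * x)) * char M ((real k - real l) * T))"
      by (simp add: char_def)
    also have "Re \<dots> \<le> norm \<dots>" by (rule complex_Re_le_cmod)
    also have "\<dots> \<le> (\<Sum>k<N. \<Sum>l<N. norm (iexp (- ((real k - real l) * T * x)) * char M ((real k - real l) * T)))"
      by (intro order_trans[OF norm_sum] sum_mono order_refl)
    \<comment> \<open>Diagonal terms have modulus 1. Off the diagonal the frequency has modulus at
      least \<open>T\<close>, so the term is at most e. Dividing the total by N^2 leaves 1 / N +
      e.\<close>
    also have "\<dots> \<le> (\<Sum>k<N. \<Sum>l<N. of_bool (k = l) + e)"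
    proof (intro sum_mono)
      fix k l
      show "norm (iexp (- ((real k - real l) * T * x)) * char M ((real k - real l) * T)) \<le> of_bool (k = l) + e"
      proof (cases "k = l")
        case True
        then show ?thesis using e by (simp add: char_zero)
      next
        case False
        then have "1 \<le> \<bar>real k - real l\<bar>" by linarith
        then have "1 * T \<le> \<bar>real k - real l\<bar> * T" by (intro mult_right_mono) (auto simp: T_def)
        then have "T \<le> \<bar>(real k - real l) * T\<bar>" by (simp add: abs_mult T_def)
        then show ?thesis using T False by (simp add: norm_mult del: of_real_mult)
      qed
    qed
    also have "\<dots> = real N + (real N)\<^sup>2 * e"
      by (simp add: sum.distrib power2_eq_square of_bool_def algebra_simps)
    finally have "(real N)\<^sup>2 * measure M {x} \<le> (real N)\<^sup>2 * (1 / real N + e)"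
      using N by (simp add: power2_eq_square algebra_simps)
    then show ?thesis using N by simp
  qed
  have "measure M {x} \<le> e" if "0 < e" for e
  proof -
    obtain N where N: "0 < N" "1 / real N < e / 2"
      using reals_Archimedean[of "e / 2"] \<open>0 < e\<close> by (metis half_gt_zero inverse_eq_divide zero_less_Suc)
    with le[of "e / 2" N] \<open>0 < e\<close> show ?thesis by simp
  qed
  then show ?thesis using measure_nonneg[of M "{x}"] by (meson dense_ge_bounded dual_order.antisym not_less dense_ge)
qed

subsection \<open>Sums of reciprocals\<close>

text \<open>Here \<open>a\<close> is the exponent \<alpha> of the theorem, so that a - 1 is
  \<beta>.\<close>

locale reciprocal_sample = prob_space M for M :: "'a measure" +
  fixes X :: "nat \<Rightarrow> 'a \<Rightarrow> real" and f :: "real \<Rightarrow> real" and c a :: real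
  assumes indep: "indep_vars (\<lambda>_. borel) X UNIV"
    and AE_nonneg: "\<And>i. AE \<omega> in M. 0 \<le> X i \<omega>"
    and f_nonneg: "\<And>x. 0 \<le> f x"
    and density: "\<And>i. distributed M lborel (X i) (\<lambda>x. ennreal (f x))"
    and c: "0 < c"
    and density_at_0: "((\<lambda>x. f x / (c * x powr (a - 1))) \<longlongrightarrow> 1) (at_right 0)"
    and a: "0 < a" "a < 1"
begin

lemma X_measurable [measurable]: "X i \<in> borel_measurable M"
  using indep by (auto simp: indep_vars_def)

lemma f_measurable [measurable]: "f \<in> borel_measurable borel"
  using distributed_real_measurable[OF f_nonneg density] by simp

lemma expectation_X:
  fixes g :: "real \<Rightarrow> 'b::{banach, second_countable_topology}"
  assumes [measurable]: "g \<in> borel_measurable borel"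
  shows "expectation (\<lambda>\<omega>. g (X i \<omega>)) = (\<integral>x. f x *\<^sub>R g x \<partial>lborel)"
proof -
  have "expectation (\<lambda>\<omega>. g (X i \<omega>)) = (\<integral>x. g x \<partial>distr M lborel (X i))"
    by (simp add: integral_distr)
  also have "distr M lborel (X i) = density lborel (\<lambda>x. ennreal (f x))"
    by (rule distributed_distr_eq_density[OF density])
  finally show ?thesis using f_nonneg by (simp add: integral_density)
qed

lemma f_integrable: "integrable lborel f"
  using distributed_integrable[OF density, of "\<lambda>_. 1" 0] f_nonneg by simp

text \<open>A law with a density gives no mass to 0; hence almost surely no reciprocal takes the
  default value 1 / 0 = 0.\<close>

lemma AE_pos: "AE \<omega> in M. 0 < X i \<omega>"
proof -
  have "expectation (\<lambda>\<omega>. indicator {0} (X i \<omega>) :: real) = (\<integral>x. f x *\<^sub>R indicator {0} x \<partial>lborel)"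
    by (rule expectation_X) simp
  also have "\<dots> = (\<integral>x. 0 \<partial>(lborel :: real measure))"
    by (intro integral_cong_AE) (auto intro!: eventually_mono[OF AE_lborel_singleton[of 0]])
  finally have "expectation (\<lambda>\<omega>. indicator {0} (X i \<omega>) :: real) = 0" by simp
  moreover have "prob (X i -` {0} \<inter> space M) = expectation (indicator (X i -` {0} \<inter> space M))"
    by simp
  moreover have "\<dots> = expectation (\<lambda>\<omega>. indicator {0} (X i \<omega>) :: real)"
    by (intro Bochner_Integration.integral_cong) (auto simp: indicator_def)
  ultimately have "prob (X i -` {0} \<inter> space M) = 0" by (simp only:)
  then have "AE \<omega> in M. \<omega> \<notin> X i -` {0} \<inter> space M"
    by (intro AE_not_in) (auto simp: null_sets_def emeasure_eq_measure)
  with AE_nonneg[of i] AE_space show ?thesis by eventually_elim auto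
qed

lemma AE_pos_all: "AE \<omega> in M. \<forall>i. 0 < X i \<omega>"
  by (simp add: AE_all_countable AE_pos)

text \<open>This is Y_n = n^(1 - 1 / \<alpha>) / H_n, with the power of n moved into the
  summands.\<close>

definition scaled_sum :: "nat \<Rightarrow> 'a \<Rightarrow> real" where
  "scaled_sum n \<omega> = (\<Sum>i<n. 1 / (real n powr (1 / a) * X i \<omega>))"

definition law :: "nat \<Rightarrow> real measure" where
  "law n = distr M borel (scaled_sum n)"

lemma scaled_sum_measurable [measurable]: "scaled_sum n \<in> borel_measurable M"
  unfolding scaled_sum_def by measurable

lemma real_distribution_law: "real_distribution (law n)"
  unfolding law_def by (rule real_distribution_distr) simp

lemma measure_law:
  "A \<in> sets borel \<Longrightarrow> measure (law n) A = prob {\<omega> \<in> space M. scaled_sum n \<omega> \<in> A}"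
  unfolding law_def by (subst measure_distr) (auto intro!: arg_cong[where f=prob])

lemma AE_scaled_sum_nonneg: "AE \<omega> in M. 0 \<le> scaled_sum n \<omega>"
  using AE_pos_all by eventually_elim (auto simp: scaled_sum_def less_imp_le intro!: sum_nonneg)

lemma measure_law_neg: "measure (law n) {..<0} = 0"
proof -
  have "prob {\<omega> \<in> space M. scaled_sum n \<omega> \<in> {..<0}} = prob {}"
    using AE_scaled_sum_nonneg[of n] by (intro finite_measure_eq_AE) (auto elim!: eventually_mono)
  then show ?thesis by (subst measure_law) auto
qed

text \<open>By independence the characteristic function is the n-th power of that of one summand,
  \<open>w n\<close>. The rescaled integral of 1 - exp(i t / y) is n (1 - w_n), so its limit becomes
  the exponent through \<open>power_tendsto_exp\<close>.\<close>

lemma char_law_tendsto: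
  "(\<lambda>n. char (law n) t) \<longlonglongrightarrow> exp (- (c *\<^sub>R stable_exponent a t))"
proof -
  define w where "w n = expectation (\<lambda>\<omega>. iexp (t * (1 / (real n powr (1 / a) * X 0 \<omega>))))" for n
  define g where "g y = indicator {0<..} y *\<^sub>R (1 - iexp (t / y))" for y
  have [measurable]: "g \<in> borel_measurable borel" unfolding g_def by measurable
  have w_eq: "w n = expectation (\<lambda>\<omega>. iexp (t * (1 / (real n powr (1 / a) * X i \<omega>))))" for n i
    unfolding w_def
    by (subst (1 2) expectation_X[where g="\<lambda>x. iexp (t * (1 / (real n powr (1 / a) * x)))" for n]) auto
  have char_pow: "char (law n) t = w n ^ n" for n
  proof -
    have "indep_vars (\<lambda>_. borel) (\<lambda>i \<omega>. 1 / (real n powr (1 / a) * X i \<omega>)) {..<n}"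
      by (rule indep_vars_compose2[OF indep_vars_subset[OF indep subset_UNIV]]) measurable
    from char_distr_sum[OF this, of t]
    have "char (law n) t = (\<Prod>i<n. char (distr M borel (\<lambda>\<omega>. 1 / (real n powr (1 / a) * X i \<omega>))) t)"
      by (simp add: law_def scaled_sum_def[abs_def])
    also have "\<dots> = (\<Prod>i<n. w n)"
    proof (intro prod.cong refl)
      fix i
      have "char (distr M borel (\<lambda>\<omega>. 1 / (real n powr (1 / a) * X i \<omega>))) t
          = expectation (\<lambda>\<omega>. iexp (t * (1 / (real n powr (1 / a) * X i \<omega>))))"
        unfolding char_def by (rule integral_distr) auto
      then show "char (distr M borel (\<lambda>\<omega>. 1 / (real n powr (1 / a) * X i \<omega>))) t = w n"
        by (simp only: w_eq[of n i])
    qed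
    finally show ?thesis by simp
  qed
  have "(\<lambda>n. real n *\<^sub>R (\<integral>x. f x *\<^sub>R g (real n powr (1 / a) * x) \<partial>lborel))
      \<longlonglongrightarrow> c *\<^sub>R (\<integral>y. y powr (a - 1) *\<^sub>R g y \<partial>lborel)"
    using norm_one_minus_iexp_le[of _ t]
    by (intro rescaled_integral_limit[where C="2 + \<bar>t\<bar>"] a c f_nonneg f_integrable density_at_0) (auto simp: g_def)
  moreover have "real n *\<^sub>R (\<integral>x. f x *\<^sub>R g (real n powr (1 / a) * x) \<partial>lborel) = of_nat n * (1 - w n)" for n
  proof (cases "n = 0")
    case False
    have "(\<integral>x. f x *\<^sub>R g (real n powr (1 / a) * x) \<partial>lborel) = expectation (\<lambda>\<omega>. g (real n powr (1 / a) * X 0 \<omega>))"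
      by (subst expectation_X[where g="\<lambda>x. g (real n powr (1 / a) * x)"]) auto
    also have "\<dots> = expectation (\<lambda>\<omega>. 1 - iexp (t * (1 / (real n powr (1 / a) * X 0 \<omega>))))"
      using AE_pos[of 0] False by (intro integral_cong_AE) (auto simp: g_def elim!: eventually_mono)
    also have "\<dots> = 1 - w n"
    proof -
      have "integrable M (\<lambda>\<omega>. iexp (t * (1 / (real n powr (1 / a) * X 0 \<omega>))))"
        by (intro integrable_iexp) auto
      from Bochner_Integration.integral_diff[OF integrable_const this, of 1]
      show ?thesis by (simp only: w_def lebesgue_integral_const prob_space scaleR_one)
    qed
    finally show ?thesis by (simp add: scaleR_conv_of_real)
  qed simp
  ultimately have "(\<lambda>n. of_nat n * (1 - w n)) \<longlonglongrightarrow> c *\<^sub>R stable_exponent a t"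
    by (simp add: stable_exponent_def g_def)
  moreover have "norm (w n) \<le> 1" for n
  proof -
    have "norm (w n) \<le> expectation (\<lambda>\<omega>. norm (iexp (t * (1 / (real n powr (1 / a) * X 0 \<omega>)))))"
      unfolding w_def by (rule integral_norm_bound)
    then show ?thesis by (simp add: prob_space del: of_real_mult)
  qed
  ultimately show ?thesis
    unfolding char_pow using c Re_stable_exponent_nonneg[OF a, of t]
    by (intro power_tendsto_exp) auto
qed

section \<open>Large and truncated values of a single scaled reciprocal\<close>

definition hit :: "nat \<Rightarrow> real \<Rightarrow> real" where
  "hit n v = prob {\<omega> \<in> space M. real n powr (1 / a) * X 0 \<omega> \<in> {0<..v}}"

text \<open>For n \<ge> 1 and v > 0, in terms of the scaled reciprocal 1 / (n^(1 / a) X_0),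
  \<open>hit n v\<close> is the probability of a value at least 1 / v, and
  \<open>truncated_mean n v\<close> is the mean of its part with values at most 1 / v.\<close>

definition truncated_mean :: "nat \<Rightarrow> real \<Rightarrow> real" where
  "truncated_mean n v =
     expectation (\<lambda>\<omega>. indicator {v..} (real n powr (1 / a) * X 0 \<omega>) / (real n powr (1 / a) * X 0 \<omega>))"

lemma prob_hit:
  "prob {\<omega> \<in> space M. real n powr (1 / a) * X i \<omega> \<in> {0<..v}}
    = (\<integral>x. f x *\<^sub>R indicator {0<..v} (real n powr (1 / a) * x) \<partial>lborel)"
proof -
  have "prob {\<omega> \<in> space M. real n powr (1 / a) * X i \<omega> \<in> {0<..v}}
      = expectation (indicator {\<omega> \<in> space M. real n powr (1 / a) * X i \<omega> \<in> {0<..v}})"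
    by (simp add: Int_absorb2 subset_eq)
  also have "\<dots> = expectation (\<lambda>\<omega>. indicator {0<..v} (real n powr (1 / a) * X i \<omega>))"
    by (intro Bochner_Integration.integral_cong) (auto simp: indicator_def)
  also have "\<dots> = (\<integral>x. f x *\<^sub>R indicator {0<..v} (real n powr (1 / a) * x) \<partial>lborel)"
    by (rule expectation_X) simp
  finally show ?thesis .
qed

lemma hit_eq: "prob {\<omega> \<in> space M. real n powr (1 / a) * X i \<omega> \<in> {0<..v}} = hit n v"
  unfolding hit_def prob_hit ..

lemma truncated_mean_eq:
  "expectation (\<lambda>\<omega>. indicator {v..} (real n powr (1 / a) * X i \<omega>) / (real n powr (1 / a) * X i \<omega>))
    = truncated_mean n v"
  unfolding truncated_mean_def
  by (subst (1 2) expectation_X[where g="\<lambda>x. indicator {v..} (real n powr (1 / a) * x) / (real n powr (1 / a) * x)"]) auto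

lemma hit_limit:
  assumes v: "0 < v"
  shows "(\<lambda>n. real n * hit n v) \<longlonglongrightarrow> c / a * v powr a"
proof -
  have "(\<lambda>n. real n *\<^sub>R (\<integral>x. f x *\<^sub>R (indicator {0<..v} (real n powr (1 / a) * x) :: real) \<partial>lborel))
      \<longlonglongrightarrow> c *\<^sub>R (\<integral>y. y powr (a - 1) *\<^sub>R indicator {0<..v} y \<partial>lborel)"
  \<comment> \<open>The constant \<open>max 1 v\<close> works because the indicator is at most 1,
    and at most v / y on its support.\<close>
  proof (intro rescaled_integral_limit[where C="max 1 v"] a c f_nonneg f_integrable density_at_0)
    fix y :: real assume "0 < y"
    then show "norm (indicator {0<..v} y :: real) \<le> max 1 v * min 1 (1 / y)"
      using v by (auto simp: indicator_def min_def max_def divide_simps)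
  qed auto
  moreover have "hit n v = (\<integral>x. f x *\<^sub>R (indicator {0<..v} (real n powr (1 / a) * x) :: real) \<partial>lborel)" for n
    unfolding hit_def by (rule prob_hit)
  moreover have "(\<integral>y. y powr (a - 1) *\<^sub>R indicator {0<..v} y \<partial>lborel) = v powr a / a"
  proof -
    have "(\<integral>y. y powr (a - 1) *\<^sub>R indicator {0<..v} y \<partial>lborel) = (\<integral>y. indicator {0..v} y * y powr (a - 1) \<partial>lborel)"
      by (intro Bochner_Integration.integral_cong) (auto simp: indicator_def)
    also have "\<dots> = v powr a / a"
      using has_bochner_integral_powr_near_0[of a v] a v by (simp add: has_bochner_integral_integral_eq)
    finally show ?thesis .
  qed
  ultimately show ?thesis by simp
qed

lemma truncated_mean_limit:
  assumes v: "0 < v"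
  shows "(\<lambda>n. real n * truncated_mean n v) \<longlonglongrightarrow> c / (1 - a) * v powr (a - 1)"
proof -
  have "(\<lambda>n. real n *\<^sub>R (\<integral>x. f x *\<^sub>R (indicator {v..} (real n powr (1 / a) * x) / (real n powr (1 / a) * x)) \<partial>lborel))
      \<longlonglongrightarrow> c *\<^sub>R (\<integral>y. y powr (a - 1) *\<^sub>R (indicator {v..} y / y) \<partial>lborel)"
  proof (intro rescaled_integral_limit[where C="max 1 (1 / v)"] a c f_nonneg f_integrable density_at_0)
    fix y :: real assume y: "0 < y"
    show "norm (indicator {v..} y / y) \<le> max 1 (1 / v) * min 1 (1 / y)"
    proof (cases "v \<le> y")
      case True
      have "1 / y \<le> max 1 (1 / v) * 1" using True v y by (simp add: le_max_iff_disj frac_le)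
      moreover have "1 / y \<le> max 1 (1 / v) * (1 / y)" using y by (simp add: divide_simps)
      ultimately show ?thesis using True y by (simp add: min_def)
    qed (use y in \<open>auto simp: min_def max_def\<close>)
  qed (use v in \<open>auto simp: indicator_def\<close>)
  moreover have "truncated_mean n v =
      (\<integral>x. f x *\<^sub>R (indicator {v..} (real n powr (1 / a) * x) / (real n powr (1 / a) * x)) \<partial>lborel)" for n
    unfolding truncated_mean_def by (rule expectation_X) simp
  moreover have "(\<integral>y. y powr (a - 1) *\<^sub>R (indicator {v..} y / y) \<partial>lborel) = v powr (a - 1) / (1 - a)"
  proof -
    have "(\<integral>y. y powr (a - 1) *\<^sub>R (indicator {v..} y / y) \<partial>lborel) = (\<integral>y. indicator {v..} y * y powr (a - 2) \<partial>lborel)"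
    proof (intro Bochner_Integration.integral_cong refl)
      fix y :: real
      have "y powr (a - 2) = y powr (a - 1) / y" if "0 < y"
        using powr_diff[of y "a - 1" 1] that by simp
      then show "y powr (a - 1) *\<^sub>R (indicator {v..} y / y) = indicator {v..} y * y powr (a - 2)"
        using v by (auto simp: indicator_def)
    qed
    also have "\<dots> = - (v powr (a - 2 + 1)) / (a - 2 + 1)"
      using a v by (intro has_bochner_integral_integral_eq has_bochner_integral_powr_at_top) auto
    also have "\<dots> = v powr (a - 1) / (1 - a)"
      using a by (simp add: divide_simps algebra_simps)
    finally show ?thesis .
  qed
  ultimately show ?thesis by simp
qed

end

subsection \<open>Tail bounds\<close>

text \<open>The principle of one big jump. If at most one term reaches \<open>d\<close>, all the
  others count as small, so x is at most that term plus the small part; splitting x as (1 - e) x + e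
  x leaves one of the two large. If no term reaches \<open>d\<close>, the small part is the whole
  sum.\<close>

lemma large_sum_cases:
  fixes w :: "'i \<Rightarrow> real"
  assumes fin: "finite I" and w: "\<And>i. i \<in> I \<Longrightarrow> 0 \<le> w i" and sum: "x \<le> (\<Sum>i\<in>I. w i)"
    and e: "0 \<le> x" "e \<le> 1"
  shows "(\<exists>i\<in>I. (1 - e) * x \<le> w i) \<or> (\<exists>i\<in>I. \<exists>j\<in>I - {i}. d \<le> w i \<and> d \<le> w j) \<or>
    e * x \<le> (\<Sum>i\<in>I. if w i \<le> d then w i else 0)"
proof (cases "\<exists>i\<in>I. d \<le> w i")
  case False
  then have "(\<Sum>i\<in>I. if w i \<le> d then w i else 0) = (\<Sum>i\<in>I. w i)"
    by (intro sum.cong) auto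
  moreover have "e * x \<le> x" using mult_right_mono[OF e(2,1)] by simp
  ultimately show ?thesis using sum by simp
next
  case True
  then obtain i where i: "i \<in> I" "d \<le> w i" by blast
  show ?thesis
  proof (cases "\<exists>j\<in>I - {i}. d \<le> w j")
    case False
    have "(\<Sum>j\<in>I - {i}. w j) = (\<Sum>j\<in>I - {i}. if w j \<le> d then w j else 0)"
      using False by (intro sum.cong refl) (metis nle_le)
    also have "\<dots> \<le> (\<Sum>j\<in>I. if w j \<le> d then w j else 0)"
      using fin w by (intro sum_mono2) auto
    finally have "x \<le> w i + (\<Sum>j\<in>I. if w j \<le> d then w j else 0)"
      using sum sum.remove[OF fin i(1), of w] by linarith
    then have "(1 - e) * x \<le> w i \<or> e * x \<le> (\<Sum>j\<in>I. if w j \<le> d then w j else 0)"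
      by (simp add: algebra_simps) linarith
    then show ?thesis using i(1) by blast
  qed (use i in blast)
qed

context reciprocal_sample
begin

lemma truncated_integrable:
  assumes "0 < v"
  shows "integrable M (\<lambda>\<omega>. indicator {v..} (real n powr (1 / a) * X i \<omega>) / (real n powr (1 / a) * X i \<omega>) :: real)"
proof (rule integrable_const_bound[of _ "1 / v"])
  show "AE \<omega> in M. norm (indicator {v..} (real n powr (1 / a) * X i \<omega>) / (real n powr (1 / a) * X i \<omega>)) \<le> 1 / v"
  proof (intro AE_I2)
    fix \<omega>
    show "norm (indicator {v..} (real n powr (1 / a) * X i \<omega>) / (real n powr (1 / a) * X i \<omega>)) \<le> 1 / v"
      using assms by (cases "v \<le> real n powr (1 / a) * X i \<omega>") (simp_all add: frac_le)
  qed
qed simp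

text \<open>The three summands answer the three cases of \<open>large_sum_cases\<close> at threshold
  d x: a union bound for one large term, independence and a union bound over pairs for two, and
  Markov's inequality for the sum of the small terms.\<close>

lemma measure_law_upper:
  assumes x: "0 < x" and d: "0 < d" and e: "0 < e" "e < 1"
  shows "measure (law n) {x..} \<le> real n * hit n (1 / ((1 - e) * x)) + (real n * hit n (1 / (d * x)))\<^sup>2
     + real n * truncated_mean n (1 / (d * x)) / (e * x)"
proof (cases "n = 0")
  case True
  then show ?thesis using x by (simp add: measure_law scaled_sum_def)
next
  case False
  define b where "b = real n powr (1 / a)"
  have b: "0 < b" using False by (simp add: b_def)
  define v where "v = 1 / (d * x)"
  have v: "0 < v" using d x by (simp add: v_def)
  define A where "A u i = {\<omega> \<in> space M. b * X i \<omega> \<in> {0<..u}}" for u :: real and i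
  have A_sets [measurable]: "A u i \<in> sets M" for u i unfolding A_def by measurable
  have prob_A: "prob (A u i) = hit n u" for u i
    unfolding A_def b_def by (rule hit_eq)
  have prob_A2: "prob (A u i \<inter> A u j) = (hit n u)\<^sup>2" if "i \<noteq> j" for u i j
  proof -
    have "prob (\<Inter>k\<in>{i, j}. X k -` {y. b * y \<in> {0<..u}} \<inter> space M)
        = (\<Prod>k\<in>{i, j}. prob (X k -` {y. b * y \<in> {0<..u}} \<inter> space M))"
      by (rule indep_varsD[OF indep]) auto
    moreover have "X k -` {y. b * y \<in> {0<..u}} \<inter> space M = A u k" for k
      by (auto simp: A_def)
    ultimately show ?thesis using that by (simp add: prob_A power2_eq_square)
  qed
  define u where "u = 1 / ((1 - e) * x)"
  define h where "h i \<omega> = indicator {v..} (b * X i \<omega>) / (b * X i \<omega>)" for i \<omega>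
  have h_int: "integrable M (h i)" for i
    unfolding h_def b_def by (rule truncated_integrable[OF v])
  have [measurable]: "h i \<in> borel_measurable M" for i using h_int by (rule borel_measurable_integrable)
  define S where "S = {\<omega> \<in> space M. e * x \<le> (\<Sum>i<n. h i \<omega>)}"
  have [measurable]: "S \<in> sets M" unfolding S_def by measurable
  have h_nonneg: "0 \<le> h i \<omega>" for i \<omega>
    using v by (auto simp: h_def indicator_def)
  have "measure (law n) {x..} = prob {\<omega> \<in> space M. x \<le> scaled_sum n \<omega>}"
    by (simp add: measure_law)
  also have "\<dots> \<le> prob ((\<Union>i<n. A u i) \<union> (\<Union>i<n. \<Union>j\<in>{..<n} - {i}. A v i \<inter> A v j) \<union> S)"
  proof (rule finite_measure_mono_AE)
    show "AE \<omega> in M. \<omega> \<in> {\<omega> \<in> space M. x \<le> scaled_sum n \<omega>} \<longrightarrow>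
        \<omega> \<in> (\<Union>i<n. A u i) \<union> (\<Union>i<n. \<Union>j\<in>{..<n} - {i}. A v i \<inter> A v j) \<union> S"
      using AE_pos_all AE_space
    proof eventually_elim
      case (elim \<omega>)
      have p: "0 < b * X i \<omega>" for i using elim(1) b by simp
      have le: "s \<le> 1 / (b * X i \<omega>) \<longleftrightarrow> b * X i \<omega> \<le> 1 / s" if "0 < s" for s i
        using that p[of i] by (simp add: field_simps)
      show ?case
      proof
        assume "\<omega> \<in> {\<omega> \<in> space M. x \<le> scaled_sum n \<omega>}"
        then have "x \<le> (\<Sum>i<n. 1 / (b * X i \<omega>))" by (simp add: scaled_sum_def b_def)
        with large_sum_cases[of "{..<n}" "\<lambda>i. 1 / (b * X i \<omega>)" x e "d * x"] x e p
        consider i where "i < n" "(1 - e) * x \<le> 1 / (b * X i \<omega>)"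
          | i j where "i < n" "j \<in> {..<n} - {i}" "d * x \<le> 1 / (b * X i \<omega>)" "d * x \<le> 1 / (b * X j \<omega>)"
          | "e * x \<le> (\<Sum>i<n. if 1 / (b * X i \<omega>) \<le> d * x then 1 / (b * X i \<omega>) else 0)"
          by (auto simp: less_imp_le)
        then show "\<omega> \<in> (\<Union>i<n. A u i) \<union> (\<Union>i<n. \<Union>j\<in>{..<n} - {i}. A v i \<inter> A v j) \<union> S"
        proof cases
          case 1
          have "b * X i \<omega> \<le> u"
            using 1(2) le[of "(1 - e) * x" i] x e by (simp add: u_def)
          then have "\<omega> \<in> A u i" using p[of i] elim(2) by (simp add: A_def)
          then show ?thesis using 1(1) by blast
        next
          case 2
          have "b * X i \<omega> \<le> v" "b * X j \<omega> \<le> v"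
            using 2 le[of "d * x"] x d by (simp_all add: v_def)
          then have "\<omega> \<in> A v i \<inter> A v j" using p elim(2) by (simp add: A_def)
          then show ?thesis using 2(1,2) by blast
        next
          case 3
          have "(if 1 / (b * X i \<omega>) \<le> d * x then 1 / (b * X i \<omega>) else 0) = h i \<omega>" for i
          proof -
            have "1 / (b * X i \<omega>) \<le> d * x \<longleftrightarrow> v \<le> b * X i \<omega>"
              using p[of i] d x by (simp add: v_def field_simps)
            then show ?thesis by (simp add: h_def indicator_def)
          qed
          with 3 show ?thesis using elim(2) by (simp add: S_def)
        qed
      qed
    qed
  qed measurable
  also have "\<dots> \<le> prob (\<Union>i<n. A u i) + prob (\<Union>i<n. \<Union>j\<in>{..<n} - {i}. A v i \<inter> A v j) + prob S"
    by (intro order_trans[OF measure_Un_le] add_mono measure_Un_le order_refl) auto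
  also have "prob (\<Union>i<n. A u i) \<le> real n * hit n u"
    using finite_measure_subadditive_finite[of "{..<n}" "A u"] by (auto simp: prob_A image_subset_iff)
  also have "prob (\<Union>i<n. \<Union>j\<in>{..<n} - {i}. A v i \<inter> A v j) \<le> (real n * hit n v)\<^sup>2"
  proof -
    have "prob (\<Union>i<n. \<Union>j\<in>{..<n} - {i}. A v i \<inter> A v j) \<le> (\<Sum>i<n. prob (\<Union>j\<in>{..<n} - {i}. A v i \<inter> A v j))"
      by (intro finite_measure_subadditive_finite) auto
    also have "\<dots> \<le> (\<Sum>i<n. \<Sum>j\<in>{..<n} - {i}. prob (A v i \<inter> A v j))"
      by (intro sum_mono finite_measure_subadditive_finite) auto
    also have "\<dots> = (\<Sum>i<n. \<Sum>j\<in>{..<n} - {i}. (hit n v)\<^sup>2)"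
      by (intro sum.cong refl prob_A2) auto
    also have "\<dots> \<le> (\<Sum>i<n. \<Sum>j<n. (hit n v)\<^sup>2)"
      by (intro sum_mono sum_mono2) auto
    also have "\<dots> = (real n * hit n v)\<^sup>2" by (simp add: power2_eq_square)
    finally show ?thesis .
  qed
  also have "prob S \<le> real n * truncated_mean n v / (e * x)"
  proof -
    have "prob S \<le> expectation (\<lambda>\<omega>. \<Sum>i<n. h i \<omega>) / (e * x)"
      unfolding S_def using x e h_int h_nonneg
      by (intro integral_Markov_inequality_measure[where A="space M"] Bochner_Integration.integrable_sum)
         (auto intro!: AE_I2 sum_nonneg)
    also have "expectation (\<lambda>\<omega>. \<Sum>i<n. h i \<omega>) = (\<Sum>i<n. expectation (h i))"
      by (rule Bochner_Integration.integral_sum) (rule h_int)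
    also have "\<dots> = real n * truncated_mean n v"
      by (simp add: h_def[abs_def] b_def truncated_mean_eq)
    finally show ?thesis .
  qed
  finally show ?thesis by (simp add: u_def v_def)
qed

text \<open>Almost surely the summands are positive, so a sum below x forces every summand below x.
  Independence turns this into an n-th power, and 1 - h \<le> exp(-h) bounds it.\<close>

lemma measure_law_lower:
  assumes x: "0 < x"
  shows "measure (law n) {..<x} \<le> exp (- (real n * hit n (1 / x)))"
proof (cases "n = 0")
  case True
  then show ?thesis using real_distribution_law[of n]
    by (simp add: real_distribution_def prob_space.prob_le_1)
next
  case False
  define b where "b = real n powr (1 / a)"
  have b: "0 < b" using False by (simp add: b_def)
  have "measure (law n) {..<x} = prob {\<omega> \<in> space M. scaled_sum n \<omega> < x}"
    by (simp add: measure_law)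
  also have "\<dots> \<le> prob (\<Inter>i\<in>{..<n}. X i -` {y. b * y \<notin> {0<..1 / x}} \<inter> space M)"
  proof (rule finite_measure_mono_AE)
    show "AE \<omega> in M. \<omega> \<in> {\<omega> \<in> space M. scaled_sum n \<omega> < x} \<longrightarrow>
        \<omega> \<in> (\<Inter>i\<in>{..<n}. X i -` {y. b * y \<notin> {0<..1 / x}} \<inter> space M)"
      using AE_pos_all
    proof eventually_elim
      case (elim \<omega>)
      have p: "0 < b * X i \<omega>" for i using elim b by simp
      have "1 / x < b * X i \<omega>" if i: "i < n" and less: "scaled_sum n \<omega> < x" for i
      proof -
        have "1 / (b * X i \<omega>) \<le> scaled_sum n \<omega>"
          unfolding scaled_sum_def b_def[symmetric] using i p
          by (intro member_le_sum) (auto simp: less_imp_le)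
        with less have "1 / (b * X i \<omega>) < x" by simp
        then show ?thesis using p[of i] x by (simp add: field_simps)
      qed
      then show ?case by (auto simp: not_le)
    qed
    show "(\<Inter>i\<in>{..<n}. X i -` {y. b * y \<notin> {0<..1 / x}} \<inter> space M) \<in> sets M"
      using False by (intro sets.finite_INT) auto
  qed
  also have "\<dots> = (\<Prod>i<n. prob (X i -` {y. b * y \<notin> {0<..1 / x}} \<inter> space M))"
    using False by (intro indep_varsD[OF indep]) auto
  also have "\<dots> = (\<Prod>i<n. 1 - hit n (1 / x))"
  proof (intro prod.cong refl)
    fix i
    have "X i -` {y. b * y \<notin> {0<..1 / x}} \<inter> space M = space M - {\<omega> \<in> space M. b * X i \<omega> \<in> {0<..1 / x}}"
      by auto
    moreover have "prob (space M - {\<omega> \<in> space M. b * X i \<omega> \<in> {0<..1 / x}})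
        = 1 - prob {\<omega> \<in> space M. b * X i \<omega> \<in> {0<..1 / x}}"
      by (rule prob_compl) measurable
    ultimately show "prob (X i -` {y. b * y \<notin> {0<..1 / x}} \<inter> space M) = 1 - hit n (1 / x)"
      by (simp only: b_def hit_eq)
  qed
  also have "\<dots> = (1 - hit n (1 / x)) ^ n" by simp
  also have "\<dots> \<le> exp (- hit n (1 / x)) ^ n"
    using exp_ge_add_one_self[of "- hit n (1 / x)"]
    by (intro power_mono) (auto simp: hit_def)
  also have "\<dots> = exp (- (real n * hit n (1 / x)))"
    by (simp flip: exp_of_nat_mult)
  finally show ?thesis .
qed

text \<open>The limit, as n grows, of the right-hand side of
  \<open>measure_law_upper\<close>.\<close>

definition tail_bound :: "real \<Rightarrow> real \<Rightarrow> real \<Rightarrow> real" where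
  "tail_bound e d x = c / a * (1 / ((1 - e) * x)) powr a + (c / a * (1 / (d * x)) powr a)\<^sup>2
     + c / (1 - a) * (1 / (d * x)) powr (a - 1) / (e * x)"

lemma measure_law_upper_limit:
  assumes x: "0 < x" and d: "0 < d" and e: "0 < e" "e < 1"
  shows "(\<lambda>n. real n * hit n (1 / ((1 - e) * x)) + (real n * hit n (1 / (d * x)))\<^sup>2
     + real n * truncated_mean n (1 / (d * x)) / (e * x)) \<longlonglongrightarrow> tail_bound e d x"
  unfolding tail_bound_def using assms
  by (intro tendsto_intros hit_limit truncated_mean_limit) auto

text \<open>For tightness smallness is enough and fixed parameters do; the sharp tail constant
  instead calls for e and d shrinking with x.\<close>

lemma tail_bound_tendsto_0: "(tail_bound (1 / 2) 1 \<longlongrightarrow> 0) at_top"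
  unfolding tail_bound_def using a c by real_asymp

(* The parameters e and d must tend to 0 with d powr (1 - a) = o(e) and x powr (- a) = o(d powr (2 * a)). *)
lemma tail_bound_asymp:
  "((\<lambda>x. x powr a * tail_bound (x powr (- ((1 - a) / 8))) (x powr (- (1 / 4))) x) \<longlongrightarrow> c / a) at_top"
proof -
  \<comment> \<open>With d = x^(-1 / 4), the third term times x^a is of order x^(-(1 - a) / 4) / e.
    Taking e = x^(-r) with r half of (1 - a) / 4 leaves x^(-r).\<close>
  define r where "r = (1 - a) / 8"
  have r: "0 < r" using a by (simp add: r_def)
  have "((\<lambda>x. c / a * (1 - x powr (- r)) powr (- a) + (c / a)\<^sup>2 * x powr (- (a / 2)) + c / (1 - a) * x powr (- r))
      \<longlongrightarrow> c / a * (1 - 0) powr (- a) + (c / a)\<^sup>2 * 0 + c / (1 - a) * 0) at_top"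
    using a r by (intro tendsto_intros tendsto_neg_powr filterlim_ident) auto
  moreover have "\<forall>\<^sub>F x in at_top. x powr a * tail_bound (x powr (- ((1 - a) / 8))) (x powr (- (1 / 4))) x
      = c / a * (1 - x powr (- r)) powr (- a) + (c / a)\<^sup>2 * x powr (- (a / 2)) + c / (1 - a) * x powr (- r)"
    using eventually_gt_at_top[of 1]
  proof eventually_elim
    case (elim x)
    have x: "0 < x" using elim by simp
    have "x powr (- r) < 1" using elim r by (simp add: powr_less_one)
    then have 1: "x powr a * (1 / ((1 - x powr (- r)) * x)) powr a = (1 - x powr (- r)) powr (- a)"
      using x by (simp add: powr_divide powr_mult powr_minus_divide)
    have "1 / (x powr (- (1 / 4)) * x) = x powr (- (3 / 4))"
      using x powr_add[of x "- (1 / 4)" 1] by (simp add: powr_minus_divide)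
    then have p: "(1 / (x powr (- (1 / 4)) * x)) powr s = x powr (- (3 / 4) * s)" for s
      by (simp add: powr_powr)
    have 2: "x powr a * ((1 / (x powr (- (1 / 4)) * x)) powr a)\<^sup>2 = x powr (- (a / 2))"
      unfolding p by (simp add: power2_eq_square flip: powr_add)
    have "x powr a * ((1 / (x powr (- (1 / 4)) * x)) powr (a - 1) / (x powr (- r) * x))
        = x powr a * (x powr (- (3 / 4) * (a - 1)) / (x powr (- r) * x powr 1))"
      unfolding p using x by simp
    also have "\<dots> = x powr (a + (- (3 / 4) * (a - 1) - (- r + 1)))"
      by (simp only: powr_add powr_diff)
    also have "a + (- (3 / 4) * (a - 1) - (- r + 1)) = - r"
      by (simp add: r_def field_simps)
    finally have 3: "x powr a * ((1 / (x powr (- (1 / 4)) * x)) powr (a - 1) / (x powr (- r) * x)) = x powr (- r)" .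
    have "x powr a * tail_bound (x powr (- r)) (x powr (- (1 / 4))) x
        = c / a * (x powr a * (1 / ((1 - x powr (- r)) * x)) powr a)
          + (c / a)\<^sup>2 * (x powr a * ((1 / (x powr (- (1 / 4)) * x)) powr a)\<^sup>2)
          + c / (1 - a) * (x powr a * ((1 / (x powr (- (1 / 4)) * x)) powr (a - 1) / (x powr (- r) * x)))"
      unfolding tail_bound_def by (simp only: power_mult_distrib ring_distribs mult_ac times_divide_eq_right)
    then show ?case unfolding 1 2 3 by (simp add: r_def)
  qed
  ultimately show ?thesis by (subst tendsto_cong) auto
qed

lemma lower_tail_asymp: "((\<lambda>x. x powr a * (1 - exp (- (c / a * (1 / x) powr a)))) \<longlongrightarrow> c / a) at_top"
  using a c by real_asymp

end

subsection \<open>The limit law\<close>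

context reciprocal_sample
begin

text \<open>The limiting tail bound controls all large n at a single \<open>R\<close>; each of the
  finitely many other laws has its own bound, and the maximum serves for all. On the left there is
  nothing to bound, since no law charges the negative half-line.\<close>

lemma tight_law: "tight law"
  unfolding tight_def
proof (intro conjI allI impI real_distribution_law)
  fix e :: real assume e: "0 < e"
  have "\<forall>\<^sub>F x in at_top. tail_bound (1 / 2) 1 x < e"
    by (rule order_tendstoD(2)[OF tail_bound_tendsto_0 e])
  then obtain R0 where "\<And>x. R0 \<le> x \<Longrightarrow> tail_bound (1 / 2) 1 x < e"
    by (auto simp: eventually_at_top_linorder)
  then obtain R where R: "0 < R" "tail_bound (1 / 2) 1 R < e"
    using that[of "max 1 R0"] by simp
  have upper: "measure (law n) {x..} \<le> measure (law n) {y..}" if "y \<le> x" for n x y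
  proof -
    interpret L: real_distribution "law n" by (rule real_distribution_law)
    show ?thesis using that by (intro L.finite_measure_mono) auto
  qed
  have "\<forall>\<^sub>F n in sequentially. measure (law n) {R..} < e"
    using order_tendstoD(2)[OF measure_law_upper_limit[OF R(1), of 1 "1 / 2"] R(2), simplified]
    by (rule eventually_mono) (use le_less_trans[OF measure_law_upper[OF R(1), of 1 "1 / 2"]] in auto)
  then obtain N where N: "\<And>n. N \<le> n \<Longrightarrow> measure (law n) {R..} < e"
    by (auto simp: eventually_sequentially)
  have "\<exists>r. measure (law n) {r..} < e" for n
  proof -
    interpret L: real_distribution "law n" by (rule real_distribution_law)
    have "\<forall>\<^sub>F x in at_top. 1 - e < cdf (law n) x"
      using L.cdf_lim_at_top_prob e by (intro order_tendstoD) auto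
    then obtain x where x: "1 - e < cdf (law n) x"
      by (auto simp: eventually_at_top_linorder)
    have "measure (law n) {x + 1..} \<le> measure (law n) (space (law n) - {..x})"
      by (intro L.finite_measure_mono) auto
    also have "\<dots> = 1 - cdf (law n) x"
      unfolding cdf_def by (intro L.prob_compl) auto
    also have "\<dots> < e" using x by simp
    finally show ?thesis by blast
  qed
  then obtain r where r: "\<And>n. measure (law n) {r n..} < e" by metis
  define B where "B = Max (insert R (r ` {..<N}))"
  have "R \<le> B" by (simp add: B_def)
  have B: "measure (law n) {B..} < e" for n
  proof (cases "N \<le> n")
    case True
    from upper[OF \<open>R \<le> B\<close>, of n] N[OF True] show ?thesis by simp
  next
    case False
    then have "r n \<le> B" by (auto simp: B_def intro: Max_ge)
    from upper[OF this, of n] r[of n] show ?thesis by simp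
  qed
  have "0 < B" using R(1) \<open>R \<le> B\<close> by simp
  \<comment> \<open>The left end is below 0 because the interval is open there and
    \<open>law 0\<close> is the point mass at 0.\<close>
  moreover have "1 - e < measure (law n) {-1<..B}" for n
  proof -
    interpret L: real_distribution "law n" by (rule real_distribution_law)
    have "1 = measure (law n) (space (law n))" by (simp only: L.prob_space)
    also have "\<dots> \<le> measure (law n) ({..<0} \<union> {-1<..B} \<union> {B..})"
      by (intro L.finite_measure_mono) auto
    also have "\<dots> \<le> measure (law n) {..<0} + measure (law n) {-1<..B} + measure (law n) {B..}"
      by (intro order_trans[OF measure_Un_le] add_mono measure_Un_le order_refl) auto
    finally show ?thesis using B[of n] by (simp add: measure_law_neg)
  qed
  ultimately show "\<exists>x y. x < y \<and> (\<forall>n. 1 - e < measure (law n) {x<..y})"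
    by (intro exI[of _ "-1"] exI[of _ B]) auto
qed

text \<open>A subsequential limit from tightness shows that the limit function is a characteristic
  function; Levy continuity then gives convergence of the whole sequence.\<close>

lemma limit_law_exists:
  obtains G where "real_distribution G" "\<And>t. char G t = exp (- (c *\<^sub>R stable_exponent a t))" "weak_conv_m law G"
proof -
  obtain r G where r: "strict_mono r" and G: "real_distribution G" and w: "weak_conv_m (law \<circ> id \<circ> r) G"
    using tight_imp_convergent_subsubsequence[OF tight_law strict_mono_id] by blast
  have char_G: "char G t = exp (- (c *\<^sub>R stable_exponent a t))" for t
  proof (rule LIMSEQ_unique)
    show "(\<lambda>n. char ((law \<circ> id \<circ> r) n) t) \<longlonglongrightarrow> char G t"
      by (intro levy_continuity1 G w) (simp add: real_distribution_law)
    show "(\<lambda>n. char ((law \<circ> id \<circ> r) n) t) \<longlonglongrightarrow> exp (- (c *\<^sub>R stable_exponent a t))"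
      using LIMSEQ_subseq_LIMSEQ[OF char_law_tendsto r, of t] by (simp add: comp_def)
  qed
  have "weak_conv_m law G"
    by (intro levy_continuity G real_distribution_law) (simp add: char_G char_law_tendsto)
  with G char_G show thesis by (rule that)
qed

end

section \<open>Atomlessness, tails and stability of the limit law\<close>

locale reciprocal_limit = reciprocal_sample +
  fixes G :: "real measure"
  assumes real_distribution_G: "real_distribution G"
    and char_G: "\<And>t. char G t = exp (- (c *\<^sub>R stable_exponent a t))"
    and weak_conv_G: "weak_conv_m law G"
begin

sublocale G: real_distribution G
  by (rule real_distribution_G)

text \<open>By scaling, the characteristic function has modulus exp(-k t^a) for t > 0, with k > 0
  from \<open>Re_stable_exponent_pos\<close>, so it vanishes at infinity.\<close>

lemma G_no_atom: "measure G {x} = 0"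
proof (rule G.char_tendsto_0_imp_no_atom)
  define k where "k = c * Re (stable_exponent a 1)"
  have k: "0 < k" using c Re_stable_exponent_pos[OF a] by (simp add: k_def)
  have "((\<lambda>t. exp (- (k * t powr a))) \<longlongrightarrow> 0) at_top"
    using k a by real_asymp
  moreover have "\<forall>\<^sub>F t in at_top. norm (char G t) = exp (- (k * t powr a))"
    using eventually_gt_at_top[of 0]
  proof eventually_elim
    case (elim t)
    have "stable_exponent a t = t powr a *\<^sub>R stable_exponent a 1"
      using stable_exponent_scale[OF elim, of a 1] by simp
    then show ?case by (simp add: char_G norm_exp_eq_Re k_def)
  qed
  ultimately have "((\<lambda>t. norm (char G t)) \<longlongrightarrow> 0) at_top"
    by (simp add: tendsto_cong)
  then show "(char G \<longlongrightarrow> 0) at_top" by (rule tendsto_norm_zero_cancel)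
qed

text \<open>Without atoms every half-line is a continuity set, so all probabilities needed for the
  tails pass to the limit.\<close>

lemma measure_law_tendsto:
  assumes [measurable]: "A \<in> sets borel" and "frontier A \<subseteq> {x}"
  shows "(\<lambda>n. measure (law n) A) \<longlonglongrightarrow> measure G A"
proof (rule weak_conv_imp_continuity_set_conv[OF real_distribution_law real_distribution_G weak_conv_G])
  have "measure G (frontier A) \<le> measure G {x}"
    using assms by (intro G.finite_measure_mono) auto
  then show "emeasure G (frontier A) = 0"
    by (simp add: G_no_atom G.emeasure_eq_measure measure_le_0_iff)
qed simp

lemma cdf_G_nonpos:
  assumes "x \<le> 0"
  shows "cdf G x = 0"
proof -
  have "measure G {..<0} = 0"
    using measure_law_tendsto[of "{..<0}" 0]
    by (simp add: measure_law_neg frontier_def interior_open LIMSEQ_const_iff subset_eq)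
  moreover have "cdf G x \<le> measure G ({..<0} \<union> {0})"
    unfolding cdf_def using assms by (intro G.finite_measure_mono) auto
  moreover have "\<dots> \<le> measure G {..<0} + measure G {0}"
    by (intro measure_Un_le) auto
  ultimately show ?thesis using G.cdf_nonneg[of x] by (simp add: G_no_atom)
qed

lemma measure_G_atLeast: "measure G {x..} = 1 - cdf G x"
proof -
  have "measure G {x..} = measure G (space G - {..<x})"
    by (intro arg_cong[where f="measure G"]) auto
  also have "\<dots> = 1 - measure G {..<x}" by (intro G.prob_compl) auto
  also have "measure G {..<x} = cdf G x"
  proof -
    have "cdf G x = measure G ({..<x} \<union> {x})"
      unfolding cdf_def by (intro arg_cong[where f="measure G"]) auto
    also have "\<dots> = measure G {..<x} + measure G {x}"
      by (intro G.finite_measure_Union) auto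
    finally show ?thesis by (simp add: G_no_atom)
  qed
  finally show ?thesis .
qed

lemma G_tail_upper:
  assumes "0 < x" "0 < d" "0 < e" "e < 1"
  shows "1 - cdf G x \<le> tail_bound e d x"
  unfolding measure_G_atLeast[symmetric]
proof (rule LIMSEQ_le)
  show "(\<lambda>n. measure (law n) {x..}) \<longlonglongrightarrow> measure G {x..}"
    by (rule measure_law_tendsto[of _ x]) (auto simp: frontier_def)
qed (use measure_law_upper_limit[OF assms] measure_law_upper[OF assms] in auto)

lemma G_tail_lower:
  assumes "0 < x"
  shows "1 - exp (- (c / a * (1 / x) powr a)) \<le> 1 - cdf G x"
proof -
  have "measure G {..<x} \<le> exp (- (c / a * (1 / x) powr a))"
  proof (rule LIMSEQ_le)
    show "(\<lambda>n. measure (law n) {..<x}) \<longlonglongrightarrow> measure G {..<x}"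
      by (rule measure_law_tendsto[of _ x]) (auto simp: frontier_def interior_open)
    show "(\<lambda>n. exp (- (real n * hit n (1 / x)))) \<longlonglongrightarrow> exp (- (c / a * (1 / x) powr a))"
      using assms by (intro tendsto_intros hit_limit) simp
  qed (use measure_law_lower[OF assms] in auto)
  moreover have "1 - measure G {..<x} = measure G (space G - {..<x})"
    by (rule G.prob_compl[symmetric]) auto
  moreover have "space G - {..<x} = {x..}" by auto
  ultimately show ?thesis by (simp add: measure_G_atLeast)
qed

text \<open>The limit in n has been taken at fixed x, e and d, so e and d may now depend on x.
  Taking x > 1 keeps e below 1.\<close>

lemma G_tail: "((\<lambda>x. x powr a * (1 - cdf G x)) \<longlongrightarrow> c / a) at_top"
proof (rule tendsto_sandwich[OF _ _ lower_tail_asymp tail_bound_asymp])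
  show "\<forall>\<^sub>F x in at_top. x powr a * (1 - exp (- (c / a * (1 / x) powr a))) \<le> x powr a * (1 - cdf G x)"
    using eventually_gt_at_top[of 0]
    by eventually_elim (intro mult_left_mono G_tail_lower, auto)
  show "\<forall>\<^sub>F x in at_top. x powr a * (1 - cdf G x)
      \<le> x powr a * tail_bound (x powr (- ((1 - a) / 8))) (x powr (- (1 / 4))) x"
    using eventually_gt_at_top[of 1]
    by eventually_elim (use a in \<open>intro mult_left_mono G_tail_upper, auto intro!: powr_less_one\<close>)
qed

lemma G_nondegenerate: "G \<noteq> return borel z"
proof
  assume "G = return borel z"
  then have "measure G {z} = 1" by (simp add: measure_return)
  then show False by (simp add: G_no_atom)
qed

text \<open>The n-th power of the characteristic function multiplies the exponent by n, which by
  scaling is the same as replacing t by n^(1 / a) t. Uniqueness of characteristic functions gives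
  strict stability: the shift is 0.\<close>

lemma G_stable: "stable_law a G"
  unfolding stable_law_def
proof (intro conjI allI impI real_distribution_G G_nondegenerate)
  fix n :: nat assume n: "1 \<le> n"
  let ?P = "PiM {..<n} (\<lambda>_. G)"
  interpret P: prob_space ?P by (rule prob_space_PiM) (rule G.prob_space_axioms)
  have proj [measurable]: "(\<lambda>y. y i) \<in> borel_measurable ?P" if "i < n" for i
    using measurable_component_singleton[of i "{..<n}" "\<lambda>_. G"] that by simp
  have comp: "distr ?P borel (\<lambda>y. y i) = G" if "i < n" for i
  proof -
    have "distr ?P borel (\<lambda>y. y i) = distr ?P G (\<lambda>y. y i)"
      by (intro distr_cong) auto
    also have "\<dots> = G" using that by (intro distr_PiM_component) (auto simp: G.prob_space_axioms)
    finally show ?thesis .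
  qed
  \<comment> \<open>Under the product measure the joint law of the coordinates is the measure
    itself, which is the product of their marginals; this is independence.\<close>
  have indep_proj: "P.indep_vars (\<lambda>_. borel) (\<lambda>i y. y i) {..<n}"
  proof (subst P.indep_vars_iff_distr_eq_PiM')
    have "distr ?P (PiM {..<n} (\<lambda>_. borel)) (\<lambda>y. \<lambda>i\<in>{..<n}. y i) = distr ?P ?P (\<lambda>y. y)"
      by (intro distr_cong sets_PiM_cong) (auto simp: space_PiM)
    also have "\<dots> = ?P" by (rule distr_id)
    also have "\<dots> = PiM {..<n} (\<lambda>i. distr ?P borel (\<lambda>y. y i))"
      by (intro PiM_cong refl comp[symmetric]) simp
    finally show "distr ?P (PiM {..<n} (\<lambda>_. borel)) (\<lambda>y. \<lambda>i\<in>{..<n}. y i)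
        = PiM {..<n} (\<lambda>i. distr ?P borel (\<lambda>y. y i))" .
  qed (use n in \<open>auto simp: lessThan_empty_iff\<close>)
  have "distr ?P borel (\<lambda>y. \<Sum>i<n. y i) = distr G borel (\<lambda>y. real n powr (1 / a) * y + 0)"
  proof (rule Levy_uniqueness)
    show "real_distribution (distr ?P borel (\<lambda>y. \<Sum>i<n. y i))"
      by (rule P.real_distribution_distr) auto
    show "real_distribution (distr G borel (\<lambda>y. real n powr (1 / a) * y + 0))"
      by (rule G.real_distribution_distr) simp
    show "char (distr ?P borel (\<lambda>y. \<Sum>i<n. y i)) = char (distr G borel (\<lambda>y. real n powr (1 / a) * y + 0))"
    proof
      fix t
      have "char (distr ?P borel (\<lambda>y. \<Sum>i<n. y i)) t = (\<Prod>i<n. char G t)"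
        unfolding P.char_distr_sum[OF indep_proj] by (intro prod.cong refl) (simp add: comp)
      also have "\<dots> = exp (- (c *\<^sub>R (real n *\<^sub>R stable_exponent a t)))"
        by (simp add: char_G scaleR_conv_of_real mult_ac flip: exp_of_nat_mult)
      also have "real n *\<^sub>R stable_exponent a t = stable_exponent a (real n powr (1 / a) * t)"
        using n a by (subst stable_exponent_scale) (simp_all add: powr_powr)
      also have "exp (- (c *\<^sub>R \<dots>)) = char G (real n powr (1 / a) * t)"
        by (simp add: char_G)
      also have "\<dots> = char (distr G borel (\<lambda>y. real n powr (1 / a) * y + 0)) t"
        by (simp add: char_def integral_distr mult_ac)
      finally show "char (distr ?P borel (\<lambda>y. \<Sum>i<n. y i)) t
          = char (distr G borel (\<lambda>y. real n powr (1 / a) * y + 0)) t" .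
    qed
  qed
  then show "\<exists>d. distr ?P borel (\<lambda>y. \<Sum>i<n. y i) = distr G borel (\<lambda>y. real n powr (1 / a) * y + d)" ..
qed

lemma stable_law_weights_G: "stable_law_weights a 1 0 G"
  unfolding stable_law_weights_def
proof (intro conjI exI[of _ "c / a"] G_stable)
  show "((\<lambda>x. x powr a * (1 - cdf G x)) \<longlongrightarrow> c / a * 1) at_top"
    using G_tail by simp
  have "\<forall>\<^sub>F x in at_top. x powr a * cdf G (- x) = 0"
    using eventually_gt_at_top[of 0] by eventually_elim (simp add: cdf_G_nonpos)
  then show "((\<lambda>x. x powr a * cdf G (- x)) \<longlongrightarrow> c / a * 0) at_top"
    by (simp add: tendsto_eventually)
qed (use a c in auto)

section \<open>Law of the reciprocal of the limit variable\<close>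

definition inverse_law :: "real measure" where
  "inverse_law = distr G borel inverse"

lemma real_distribution_inverse_law: "real_distribution inverse_law"
  unfolding inverse_law_def by (rule G.real_distribution_distr) simp

text \<open>The value inverse 0 = 0 is thereby irrelevant to \<open>inverse_law\<close>, and
  inversion reverses order almost everywhere.\<close>

lemma AE_G_pos: "AE y in G. 0 < y"
proof -
  have "emeasure G {..0} = 0"
    using cdf_G_nonpos[of 0] by (simp add: cdf_def G.emeasure_eq_measure)
  then have "AE y in G. y \<notin> {..0}" by (intro AE_not_in) (auto simp: null_sets_def)
  then show ?thesis by eventually_elim auto
qed

lemma AE_inverse_law_pos: "AE y in inverse_law. 0 < y"
  unfolding inverse_law_def using AE_G_pos by (subst AE_distr_iff) auto

lemma cdf_inverse_law:
  assumes "0 < x"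
  shows "cdf inverse_law x = 1 - cdf G (1 / x)"
proof -
  have "cdf inverse_law x = measure G (inverse -` {..x} \<inter> space G)"
    unfolding cdf_def inverse_law_def by (rule measure_distr) auto
  also have "\<dots> = measure G {1 / x..}"
  proof (rule G.finite_measure_eq_AE)
    show "AE y in G. y \<in> inverse -` {..x} \<inter> space G \<longleftrightarrow> y \<in> {1 / x..}"
      using AE_G_pos by eventually_elim (use assms in \<open>auto simp: field_simps\<close>)
    show "inverse -` {..x} \<inter> space G \<in> sets G"
      using measurable_sets[of inverse borel borel "{..x}"] by simp
  qed simp
  finally show ?thesis by (simp add: measure_G_atLeast)
qed

text \<open>A continuous mapping argument: inversion is discontinuous only at 0, which is null for
  \<open>G\<close>, so a bounded continuous test function composed with it is continuous almost
  everywhere.\<close>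

lemma weak_conv_inverse: "weak_conv_m (\<lambda>n. distr (law n) borel inverse) inverse_law"
proof (rule integral_bdd_continuous_conv_imp_weak_conv)
  show "real_distribution (distr (law n) borel inverse)" for n
  proof -
    interpret L: real_distribution "law n" by (rule real_distribution_law)
    show ?thesis by (rule L.real_distribution_distr) simp
  qed
  show "real_distribution inverse_law" by (rule real_distribution_inverse_law)
  fix h :: "real \<Rightarrow> real"
  assume cont: "\<And>x. isCont h x" and bdd: "\<And>x. \<bar>h x\<bar> \<le> 1"
  have [measurable]: "h \<in> borel_measurable borel"
    by (intro borel_measurable_continuous_onI continuous_at_imp_continuous_on) (simp add: cont)
  have "(\<lambda>n. integral\<^sup>L (law n) (\<lambda>y. h (inverse y))) \<longlonglongrightarrow> integral\<^sup>L G (\<lambda>y. h (inverse y))"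
  proof (rule weak_conv_imp_bdd_ae_continuous_conv[OF real_distribution_law real_distribution_G weak_conv_G])
    have "{x. \<not> isCont (\<lambda>y. h (inverse y)) x} \<subseteq> {0}"
    proof
      fix y assume y: "y \<in> {x. \<not> isCont (\<lambda>y. h (inverse y)) x}"
      show "y \<in> {0}"
      proof (rule ccontr)
        assume "y \<notin> {0}"
        then have "isCont (\<lambda>x. inverse x) y" by (intro continuous_intros) auto
        from isCont_o2[OF this cont] y show False by simp
      qed
    qed
    then have "emeasure G {x. \<not> isCont (\<lambda>y. h (inverse y)) x} \<le> emeasure G {0}"
      by (intro emeasure_mono) auto
    then show "emeasure G {x. \<not> isCont (\<lambda>y. h (inverse y)) x} = 0"
      by (simp add: G.emeasure_eq_measure[of "{0}"] G_no_atom)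
    show "norm (h (inverse x)) \<le> 1" for x using bdd by simp
  qed simp
  moreover have "integral\<^sup>L (distr (law n) borel inverse) h = integral\<^sup>L (law n) (\<lambda>y. h (inverse y))" for n
    by (rule integral_distr) (auto simp: law_def)
  moreover have "integral\<^sup>L inverse_law h = integral\<^sup>L G (\<lambda>y. h (inverse y))"
    unfolding inverse_law_def by (rule integral_distr) auto
  ultimately show "(\<lambda>n. integral\<^sup>L (distr (law n) borel inverse) h) \<longlonglongrightarrow> integral\<^sup>L inverse_law h"
    by simp
qed

end

theorem theoremL:
  fixes M :: "'a measure" and X :: "nat \<Rightarrow> 'a \<Rightarrow> real" and f :: "real \<Rightarrow> real"
    and c \<alpha> \<beta> :: real
  assumes "prob_space M"
    and "prob_space.indep_vars M (\<lambda>_. borel) X UNIV"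
    and "\<And>i. AE \<omega> in M. X i \<omega> \<in> {0..1}"
    and "\<And>x. 0 \<le> f x"
    and "\<And>i. distributed M lborel (X i) (\<lambda>x. ennreal (f x))"
    and "0 < c"
    and "((\<lambda>x. f x / (c * x powr \<beta>)) \<longlongrightarrow> 1) (at_right 0)"
    and "\<alpha> = 1 + \<beta>" and "0 < \<alpha>" and "\<alpha> < 1"
  defines "H \<equiv> \<lambda>n \<omega>. harmonic_mean n (\<lambda>i. X i \<omega>)"
  shows "\<exists>G. stable_law_weights \<alpha> 1 0 G \<and>
           weak_conv_m (\<lambda>n. distr M borel (\<lambda>\<omega>. real n powr (1 - 1 / \<alpha>) / H n \<omega>)) G \<and>
           (\<exists>L. real_distribution L \<and> (AE y in L. 0 < y) \<and>
                (\<forall>x>0. cdf L x = 1 - cdf G (1 / x)) \<and>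
                weak_conv_m (\<lambda>n. distr M borel (\<lambda>\<omega>. H n \<omega> / real n powr (1 - 1 / \<alpha>))) L)"
proof -
  interpret prob_space M by fact
  interpret reciprocal_sample M X f c \<alpha>
  proof unfold_locales
    show "AE \<omega> in M. 0 \<le> X i \<omega>" for i
      using assms(3)[of i] by eventually_elim simp
  qed (use assms in auto)
  obtain G where G: "real_distribution G" "\<And>t. char G t = exp (- (c *\<^sub>R stable_exponent \<alpha> t))" "weak_conv_m law G"
    by (rule limit_law_exists) (rule that)
  interpret reciprocal_limit M X f c \<alpha> G
    by (intro reciprocal_limit.intro reciprocal_limit_axioms.intro reciprocal_sample_axioms G)
  \<comment> \<open>The factor n in H_n combines with n^(1 - 1 / \<alpha>) to n^(-1 / \<alpha>); for
    n = 0 both sides are 0.\<close>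
  have Y: "real n powr (1 - 1 / \<alpha>) / H n \<omega> = scaled_sum n \<omega>" for n \<omega>
  proof (cases "n = 0")
    case False
    have "real n powr (1 - 1 / \<alpha>) / H n \<omega> = real n powr (1 - 1 / \<alpha>) / real n * (\<Sum>i<n. 1 / X i \<omega>)"
      by (simp add: H_def harmonic_mean_def field_simps)
    also have "real n powr (1 - 1 / \<alpha>) / real n = 1 / real n powr (1 / \<alpha>)"
      using False by (simp add: powr_diff)
    finally show ?thesis by (simp add: scaled_sum_def sum_distrib_left)
  qed (simp add: H_def harmonic_mean_def scaled_sum_def)
  have law_Y: "distr M borel (\<lambda>\<omega>. real n powr (1 - 1 / \<alpha>) / H n \<omega>) = law n" for n
    by (simp add: Y law_def)
  \<comment> \<open>This holds at every \<omega>, zero denominators included, because division by 0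
    gives 0.\<close>
  have "H n \<omega> / real n powr (1 - 1 / \<alpha>) = inverse (scaled_sum n \<omega>)" for n \<omega>
    unfolding Y[symmetric] by simp
  then have law_H: "distr M borel (\<lambda>\<omega>. H n \<omega> / real n powr (1 - 1 / \<alpha>)) = distr (law n) borel inverse" for n
    by (simp add: law_def distr_distr comp_def)
  show ?thesis
    unfolding law_Y law_H
    using stable_law_weights_G G(3) real_distribution_inverse_law AE_inverse_law_pos cdf_inverse_law weak_conv_inverse
    by blast
qed

end
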